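(* Let $(Y, \|\cdot\|_Y)$ and $(U, \|\cdot\|_U)$ be real Banach spaces that are uniformly convex and uniformly smooth, let $p \in (1,\infty)$, and let $S\colon U \to Y$ be a function that is not affine-linear and that satisfies: whenever a sequence $(u_n)_{n\in\mathbb{N}} \subset U$ converges weakly in $U$ to some $u \in U$, the sequence $(S(u_n))_{n\in\mathbb{N}}$ converges weakly in $Y$ to $S(u)$. Then there exists a tuple $(y_d, u_d) \in Y \times U$ such that the problem $$\min_{(y,u) \in Y \times U}\ \|y-y_d\|_Y^p + \|u-u_d\|_U^p \quad \text{s.t. } y = S(u)$$ possesses more than one global solution.
   Context: A global solution of the problem is a pair $(\bar y, \bar u) \in Y \times U$ with $\bar y = S(\bar u)$ and $\|\bar y-y_d\|_Y^p + \|\bar u-u_d\|_U^p \le \|S(u)-y_d\|_Y^p + \|u-u_d\|_U^p$ for all $u \in U$. A function $S\colon U \to Y$ is called affine-linear if there exist a linear map $L\colon U \to Y$ and an element $c \in Y$ with $S(u) = L u + c$ for all $u \in U$. *)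

theory Defs
  imports "HOL-Analysis.Analysis"
begin

text \<open>Geometric properties of a norm are predicates on the space, passed as a type token
  \<open>TYPE('a)\<close>. In the zero space both properties hold vacuously.\<close>

definition uniformly_convex :: "'a::real_normed_vector itself \<Rightarrow> bool" where
  "uniformly_convex _ \<longleftrightarrow>
     (\<forall>\<epsilon>>0. \<exists>\<delta>>0. \<forall>x y :: 'a. norm x = 1 \<longrightarrow> norm y = 1 \<longrightarrow> norm (x - y) \<ge> \<epsilon> \<longrightarrow>
        norm ((x + y) /\<^sub>R 2) \<le> 1 - \<delta>)"

text \<open>Writing \<open>y = \<tau> *\<^sub>R v\<close> with \<open>norm v = 1\<close>, this says that the modulus of smoothness
  \<open>\<rho>(\<tau>) = sup {(norm (x + \<tau> *\<^sub>R v) + norm (x - \<tau> *\<^sub>R v)) / 2 - 1 | norm x = 1, norm v = 1}\<close>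
  satisfies \<open>\<rho>(\<tau>) / \<tau> \<longrightarrow> 0\<close> as \<open>\<tau> \<longrightarrow> 0+\<close>.\<close>

definition uniformly_smooth :: "'a::real_normed_vector itself \<Rightarrow> bool" where
  "uniformly_smooth _ \<longleftrightarrow>
     (\<forall>\<epsilon>>0. \<exists>\<delta>>0. \<forall>x y :: 'a. norm x = 1 \<longrightarrow> norm y \<le> \<delta> \<longrightarrow>
        (norm (x + y) + norm (x - y)) / 2 - 1 \<le> \<epsilon> * norm y)"

definition converges_weakly :: "(nat \<Rightarrow> 'a::real_normed_vector) \<Rightarrow> 'a \<Rightarrow> bool" where
  "converges_weakly X x \<longleftrightarrow>
     (\<forall>f :: 'a \<Rightarrow> real. bounded_linear f \<longrightarrow> (\<lambda>n. f (X n)) \<longlonglongrightarrow> f x)"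

definition weakly_seq_continuous ::
    "('u::real_normed_vector \<Rightarrow> 'y::real_normed_vector) \<Rightarrow> bool" where
  "weakly_seq_continuous S \<longleftrightarrow>
     (\<forall>X u. converges_weakly X u \<longrightarrow> converges_weakly (\<lambda>n. S (X n)) (S u))"

text \<open>The linear part is not required to be bounded.\<close>

definition affine_linear :: "('u::real_vector \<Rightarrow> 'y::real_vector) \<Rightarrow> bool" where
  "affine_linear S \<longleftrightarrow> (\<exists>L c. linear L \<and> (\<forall>u. S u = L u + c))"

definition global_solution ::
    "real \<Rightarrow> ('u::real_normed_vector \<Rightarrow> 'y::real_normed_vector) \<Rightarrow> 'y \<Rightarrow> 'u \<Rightarrow> 'y \<times> 'u \<Rightarrow> bool" where
  "global_solution p S y\<^sub>d u\<^sub>d = (\<lambda>(y, u). y = S u \<and>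
     (\<forall>v. norm (y - y\<^sub>d) powr p + norm (u - u\<^sub>d) powr p
          \<le> norm (S v - y\<^sub>d) powr p + norm (v - u\<^sub>d) powr p))"

end

theory Submission
  imports Defs "HOL-Complex_Analysis.Great_Picard"
begin

text \<open>If every problem had at most one solution, then the graph of \<open>S\<close> would be a Chebyshev set in
  \<open>Y \<times> U\<close> with the \<open>p\<close>-sum norm: minimizing sequences have weakly convergent subsequences, and the
  weak sequential continuity of \<open>S\<close> puts the limit on the graph. Since the norms have the Kadec--Klee
  property, such subsequences even converge strongly, so the metric projection onto the graph is
  continuous. By Vlasov's theorem a set with a continuous metric projection in a uniformly smooth
  Banach space is convex, and a function with a convex graph is affine-linear.\<close>

section \<open>Weak compactness\<close>

text \<open>The two geometric hypotheses have separate tasks. Uniform convexity produces strong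
  limits: of nearly minimal points in convex hulls of tails, and of weakly convergent sequences
  whose norms converge. Uniform smoothness produces functionals: the derivative of the norm at a
  point is a functional norming that point, and smoothness lets norms control the values of a given
  functional. Together they give weak compactness without passing through a dual or bidual. In the
  product, only smoothness of the \<open>p\<close>-sum norm is established. This is where
  \<open>1 < p\<close> enters: for \<open>p = 1\<close> the sum of the norms has a kink where one
  component vanishes. Convexity is used factor by factor, because convergence of the objective
  splits into convergence of its two summands. A limit of projections is always a nearest point of
  the limit; uniqueness serves to identify it with the chosen projection.\<close>

lemma uniformly_convexD:
  fixes d :: real
  assumes uc: "uniformly_convex TYPE('a::real_normed_vector)" and d: "0 \<le> d" and e: "0 < e"
  obtains \<eta> where "0 < \<eta>"
    "\<And>x y :: 'a. \<lbrakk>norm x \<le> d + \<eta>; norm y \<le> d + \<eta>; d - \<eta> \<le> norm ((x + y) /\<^sub>R 2)\<rbrakk>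
      \<Longrightarrow> norm (x - y) < e"
proof (cases "d = 0")
  case True
  have "norm (x - y) < e" if "norm x \<le> d + e / 3" "norm y \<le> d + e / 3" for x y :: 'a
    using norm_triangle_ineq4[of x y] that True e by simp
  then show thesis
    using e by (intro that[of "e / 3"]) auto
next
  case False
  then have d: "0 < d" using d by simp
  obtain \<delta> where \<delta>: "0 < \<delta>" and uc: "\<And>x y :: 'a. \<lbrakk>norm x = 1; norm y = 1; e / (2 * d) \<le> norm (x - y)\<rbrakk>
      \<Longrightarrow> norm ((x + y) /\<^sub>R 2) \<le> 1 - \<delta>"
    using uc[unfolded uniformly_convex_def, rule_format, of "e / (2 * d)"] d e by auto
  \<comment> \<open>\<open>d / 6\<close> keeps \<open>x\<close> and \<open>y\<close> away from 0, so
    that they can be normalised; \<open>d * \<delta> / 8\<close> keeps the midpoint defect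
    \<open>4 * \<eta> / d\<close> below \<open>\<delta>\<close>; \<open>e / 24\<close> keeps the
    normalisation error \<open>6 * \<eta>\<close> below \<open>e / 2\<close>.\<close>
  define \<eta> where "\<eta> = min (d / 6) (min (d * \<delta> / 8) (e / 24))"
  have \<eta>: "0 < \<eta>" "6 * \<eta> \<le> d" "8 * \<eta> \<le> d * \<delta>" "24 * \<eta> \<le> e"
  proof -
    have "\<eta> \<le> d / 6" "\<eta> \<le> d * \<delta> / 8" "\<eta> \<le> e / 24" by (simp_all add: \<eta>_def)
    then show "6 * \<eta> \<le> d" "8 * \<eta> \<le> d * \<delta>" "24 * \<eta> \<le> e" by linarith+
    show "0 < \<eta>" using d \<delta> e by (simp add: \<eta>_def)
  qed
  show thesis
  proof (rule that[OF \<eta>(1)])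
    fix x y :: 'a
    assume xy: "norm x \<le> d + \<eta>" "norm y \<le> d + \<eta>" "d - \<eta> \<le> norm ((x + y) /\<^sub>R 2)"
    have nd: "norm (z /\<^sub>R d) = norm z / d" for z :: 'a
      using d by (simp add: divide_inverse mult.commute)
    have "2 * d - 2 * \<eta> \<le> norm (x + y)" using xy(3) by simp
    then have low: "d - 3 * \<eta> \<le> norm x" "d - 3 * \<eta> \<le> norm y"
      using norm_triangle_ineq[of x y] xy(1,2) by linarith+
    then have pos: "0 < norm x" "0 < norm y" using \<eta> d by linarith+
    have near: "norm (z /\<^sub>R d - z /\<^sub>R norm z) \<le> 3 * \<eta> / d"
      if "0 < norm z" "d - 3 * \<eta> \<le> norm z" "norm z \<le> d + \<eta>" for z :: 'a
    proof -
      have "norm (z /\<^sub>R d - z /\<^sub>R norm z) = \<bar>inverse d - inverse (norm z)\<bar> * norm z"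
        by (simp add: scaleR_diff_left[symmetric])
      also have "\<dots> = \<bar>(inverse d - inverse (norm z)) * norm z\<bar>"
        by (simp add: abs_mult)
      also have "(inverse d - inverse (norm z)) * norm z = (norm z - d) / d"
        using that d by (simp add: field_simps)
      also have "\<bar>(norm z - d) / d\<bar> \<le> 3 * \<eta> / d"
        using that d \<eta> by (simp add: divide_right_mono abs_le_iff)
      finally show ?thesis .
    qed
    define a b where "a = x /\<^sub>R norm x" and "b = y /\<^sub>R norm y"
    have na: "norm (x /\<^sub>R d - a) \<le> 3 * \<eta> / d" and nb: "norm (y /\<^sub>R d - b) \<le> 3 * \<eta> / d"
      unfolding a_def b_def using near pos low xy by blast+
    have "(x + y) /\<^sub>R 2 /\<^sub>R d = (a + b) /\<^sub>R 2 + ((x /\<^sub>R d - a) + (y /\<^sub>R d - b)) /\<^sub>R 2"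
      by (simp add: algebra_simps)
    then have "norm ((x + y) /\<^sub>R 2 /\<^sub>R d)
        \<le> norm ((a + b) /\<^sub>R 2) + norm (((x /\<^sub>R d - a) + (y /\<^sub>R d - b)) /\<^sub>R 2)"
      by (metis norm_triangle_ineq)
    also have "norm (((x /\<^sub>R d - a) + (y /\<^sub>R d - b)) /\<^sub>R 2) \<le> 3 * \<eta> / d"
      using norm_triangle_ineq[of "x /\<^sub>R d - a" "y /\<^sub>R d - b"] na nb by simp
    finally have 1: "norm ((x + y) /\<^sub>R 2) / d \<le> norm ((a + b) /\<^sub>R 2) + 3 * \<eta> / d"
      unfolding nd by linarith
    have "(d - \<eta>) / d \<le> norm ((x + y) /\<^sub>R 2) / d"
      using xy(3) d by (intro divide_right_mono) auto
    then have "1 - 4 * \<eta> / d \<le> norm ((a + b) /\<^sub>R 2)"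
      using 1 d by (simp add: diff_divide_distrib)
    moreover have "4 * \<eta> / d < \<delta>" using \<eta> d \<delta> by (simp add: field_simps) 
    ultimately have "\<not> norm ((a + b) /\<^sub>R 2) \<le> 1 - \<delta>" by linarith
    moreover have "norm a = 1" "norm b = 1" using pos by (simp_all add: a_def b_def)
    ultimately have ab: "norm (a - b) < e / (2 * d)" using uc[of a b] by linarith
    have "(x - y) /\<^sub>R d = (a - b) + ((x /\<^sub>R d - a) - (y /\<^sub>R d - b))"
      by (simp add: algebra_simps)
    then have "norm ((x - y) /\<^sub>R d) \<le> norm (a - b) + norm ((x /\<^sub>R d - a) - (y /\<^sub>R d - b))"
      by (metis norm_triangle_ineq)
    then have "norm (x - y) / d < e / (2 * d) + 6 * \<eta> / d"
      using norm_triangle_ineq4[of "x /\<^sub>R d - a" "y /\<^sub>R d - b"] na nb ab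
      unfolding nd by (smt (verit) add_divide_distrib)
    then have "norm (x - y) < e / 2 + 6 * \<eta>"
      using d by (simp add: field_simps)
    then show "norm (x - y) < e" using \<eta> by linarith
  qed
qed

lemma uniformly_smoothD:
  assumes us: "uniformly_smooth TYPE('a::real_normed_vector)" and e: "0 < e"
  obtains \<delta> where "0 < \<delta>"
    "\<And>x h :: 'a. norm h \<le> \<delta> * norm x \<Longrightarrow> norm (x + h) + norm (x - h) \<le> 2 * norm x + 2 * e * norm h"
proof -
  obtain \<delta> where \<delta>: "0 < \<delta>" and us: "\<And>x h :: 'a. \<lbrakk>norm x = 1; norm h \<le> \<delta>\<rbrakk>
      \<Longrightarrow> (norm (x + h) + norm (x - h)) / 2 - 1 \<le> e * norm h"
    using us[unfolded uniformly_smooth_def, rule_format, OF e] by auto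
  show thesis
  proof (rule that[OF \<delta>])
    fix x h :: 'a
    assume h: "norm h \<le> \<delta> * norm x"
    show "norm (x + h) + norm (x - h) \<le> 2 * norm x + 2 * e * norm h"
    proof (cases "x = 0")
      case False
      define r where "r = norm x"
      have r: "0 < r" using False by (simp add: r_def)
      have "norm (h /\<^sub>R r) \<le> \<delta>" using h r by (simp add: r_def field_simps)
      moreover have "norm (x /\<^sub>R r) = 1" using r by (simp add: r_def)
      ultimately have "(norm (x /\<^sub>R r + h /\<^sub>R r) + norm (x /\<^sub>R r - h /\<^sub>R r)) / 2 - 1 \<le> e * norm (h /\<^sub>R r)"
        by (rule us[rotated])
      moreover have "norm (x /\<^sub>R r + h /\<^sub>R r) = norm (x + h) / r"
        using r by (simp flip: scaleR_add_right add: divide_inverse mult.commute)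
      moreover have "norm (x /\<^sub>R r - h /\<^sub>R r) = norm (x - h) / r"
        using r by (simp flip: scaleR_diff_right add: divide_inverse mult.commute)
      moreover have "norm (h /\<^sub>R r) = norm h / r"
        using r by (simp add: divide_inverse mult.commute)
      ultimately show ?thesis
        using r unfolding r_def[symmetric] by (simp add: field_simps)
    qed (use h in auto)
  qed
qed

text \<open>This yields a candidate for a weak limit. The distances \<open>d n\<close> of the
  decreasing tail hulls from 0 increase to some \<open>D\<close>. If \<open>x n\<close> nearly
  attains \<open>d n\<close>, the midpoint of two late terms still lies in a late hull and has norm
  close to \<open>D\<close>, so uniform convexity makes \<open>x\<close> Cauchy.\<close>

lemma tail_hulls_convergent:
  fixes u :: "nat \<Rightarrow> 'a::banach"
  assumes uc: "uniformly_convex TYPE('a)" and bdd: "\<And>n. norm (u n) \<le> M"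
  obtains x l where "\<And>n. x n \<in> convex hull (u ` {n..})" "x \<longlonglongrightarrow> l"
proof -
  define C where "C n = convex hull (u ` {n..})" for n
  define d where "d n = Inf (norm ` C n)" for n
  have ne: "u n \<in> C n" for n unfolding C_def by (intro hull_inc) auto
  have bb: "bdd_below (norm ` C n)" for n by (rule bdd_belowI[of _ 0]) auto
  have C_anti: "C m \<subseteq> C n" if "n \<le> m" for n m
    unfolding C_def using that by (intro hull_mono) auto
  have d_le: "d n \<le> norm z" if "z \<in> C n" for n z
    unfolding d_def using that bb by (intro cInf_lower) auto
  have "incseq d"
  proof (rule incseq_SucI)
    show "d n \<le> d (Suc n)" for n
      unfolding d_def using C_anti[of n "Suc n"] ne[of "Suc n"] bb[of n]
      by (intro cInf_superset_mono image_mono) auto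
  qed
  moreover have "d n \<le> M" for n using d_le[OF ne] bdd order_trans by blast
  ultimately obtain D where D: "d \<longlonglongrightarrow> D" "\<And>n. d n \<le> D"
    using incseq_convergent[of d M] by auto
  have D0: "0 \<le> D"
    using D(2)[of 0] cInf_greatest[of "norm ` C 0" 0] ne unfolding d_def by (smt (verit) empty_iff imageE image_eqI norm_ge_zero)
  have "\<exists>z \<in> C n. norm z < d n + 1 / Suc n" for n
  proof -
    have "Inf (norm ` C n) < d n + 1 / Suc n" by (simp add: d_def)
    then show ?thesis using cInf_less_iff[OF _ bb] ne by blast
  qed
  then obtain x where x: "\<And>n. x n \<in> C n" "\<And>n. norm (x n) < d n + 1 / Suc n" by metis
  have "Cauchy x"
  proof (rule CauchyI)
    fix e :: real assume "0 < e"
    then obtain \<eta> where \<eta>: "0 < \<eta>"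
      and uc: "\<And>x y :: 'a. \<lbrakk>norm x \<le> D + \<eta>; norm y \<le> D + \<eta>; D - \<eta> \<le> norm ((x + y) /\<^sub>R 2)\<rbrakk>
      \<Longrightarrow> norm (x - y) < e"
      using uniformly_convexD[OF uc D0] by metis
    have "\<forall>\<^sub>F n in sequentially. D - \<eta> < d n"
      using D(1) \<eta> by (intro order_tendstoD) auto
    moreover have "\<forall>\<^sub>F n in sequentially. 1 / Suc n < \<eta>"
      using \<eta> LIMSEQ_inverse_real_of_nat order_tendstoD(2)[of _ 0 sequentially \<eta>]
      by (auto simp: inverse_eq_divide)
    ultimately have "\<forall>\<^sub>F n in sequentially. D - \<eta> < d n \<and> 1 / Suc n < \<eta>"
      by (rule eventually_conj)
    then obtain N where N: "\<And>n. N \<le> n \<Longrightarrow> D - \<eta> < d n \<and> 1 / Suc n < \<eta>"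
      unfolding eventually_sequentially by metis
    have "norm (x m - x n) < e" if "m \<ge> N" "n \<ge> N" for m n
    proof (rule uc)
      show "norm (x m) \<le> D + \<eta>" "norm (x n) \<le> D + \<eta>"
        using x(2)[of m] x(2)[of n] N[OF that(1)] N[OF that(2)] D(2)[of m] D(2)[of n] by linarith+
      have "x m \<in> C N" "x n \<in> C N" using x(1) C_anti that by blast+
      moreover have "convex (C N)" by (simp add: C_def)
      ultimately have "(1/2) *\<^sub>R x m + (1/2) *\<^sub>R x n \<in> C N"
        by (intro convexD) auto
      then have "d N \<le> norm ((x m + x n) /\<^sub>R 2)" using d_le by (simp add: scaleR_add_right)
      then show "D - \<eta> \<le> norm ((x m + x n) /\<^sub>R 2)" using N[of N] by linarith
    qed
    then show "\<exists>N. \<forall>m\<ge>N. \<forall>n\<ge>N. norm (x m - x n) < e" by blast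
  qed
  then obtain l where "x \<longlonglongrightarrow> l" using Cauchy_convergent_iff convergent_def by blast
  then show thesis using that x(1) unfolding C_def by blast
qed

text \<open>The values \<open>f (x n)\<close> are convex combinations of late values
  \<open>f (u m)\<close>, and balls are convex. Thus the candidate is the weak limit as soon as
  every functional converges along \<open>u\<close>.\<close>

lemma tail_hulls_weak_limit:
  fixes f :: "'a::real_normed_vector \<Rightarrow> real"
  assumes x: "\<And>n. x n \<in> convex hull (u ` {n..})" "x \<longlonglongrightarrow> l"
    and f: "bounded_linear f" and conv: "(\<lambda>n. f (u n)) \<longlonglongrightarrow> c"
  shows "f l = c"
proof -
  have "(\<lambda>n. f (x n)) \<longlonglongrightarrow> c"
  proof (rule LIMSEQ_I)
    fix r :: real assume "0 < r"
    then obtain N where N: "\<And>n. n \<ge> N \<Longrightarrow> norm (f (u n) - c) < r"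
      using LIMSEQ_D[OF conv] by blast
    have "f (x n) \<in> ball c r" if "n \<ge> N" for n
    proof -
      have "f (x n) \<in> convex hull (f ` u ` {n..})"
        using x(1)[of n] convex_hull_linear_image[OF bounded_linear.linear[OF f], of "u ` {n..}"]
        by blast
      moreover have "f ` u ` {n..} \<subseteq> ball c r"
        using N that by (auto simp: dist_real_def) (smt (verit) order_trans)
      ultimately show ?thesis
        using hull_minimal[of _ _ convex] convex_ball by blast
    qed
    then show "\<exists>N. \<forall>n\<ge>N. norm (f (x n) - c) < r"
      by (auto simp: dist_real_def abs_minus_commute)
  qed
  moreover have "(\<lambda>n. f (x n)) \<longlonglongrightarrow> f l"
    using x(2) f bounded_linear.tendsto by blast
  ultimately show ?thesis using LIMSEQ_unique by blast
qed

text \<open>Coding the combinations by lists makes countability immediate, and this is what a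
  diagonal extraction requires. Rational scalars are dense enough to rescale a vector to any
  prescribed size up to a factor 2.\<close>

definition rational_span :: "(nat \<Rightarrow> 'a::real_vector) \<Rightarrow> 'a set" where
  "rational_span u = range (\<lambda>qs::(rat \<times> nat) list. \<Sum>(q, n)\<leftarrow>qs. of_rat q *\<^sub>R u n)"

lemma countable_rational_span: "countable (rational_span u)"
  unfolding rational_span_def by (intro countable_image) auto

lemma rational_span_base: "u n \<in> rational_span u"
  unfolding rational_span_def by (rule image_eqI[of _ _ "[(1, n)]"]) auto

lemma rational_span_add:
  assumes "x \<in> rational_span u" "y \<in> rational_span u"
  shows "x + y \<in> rational_span u"
proof -
  obtain qs rs :: "(rat \<times> nat) list"
    where "x = (\<Sum>(q, n)\<leftarrow>qs. of_rat q *\<^sub>R u n)" "y = (\<Sum>(q, n)\<leftarrow>rs. of_rat q *\<^sub>R u n)"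
    using assms unfolding rational_span_def by blast
  then show ?thesis
    unfolding rational_span_def by (intro image_eqI[of _ _ "qs @ rs"]) auto
qed

lemma rational_span_scale:
  assumes "x \<in> rational_span u"
  shows "of_rat r *\<^sub>R x \<in> rational_span u"
proof -
  obtain qs :: "(rat \<times> nat) list" where x: "x = (\<Sum>(q, n)\<leftarrow>qs. of_rat q *\<^sub>R u n)"
    using assms unfolding rational_span_def by blast
  have "of_rat r *\<^sub>R (\<Sum>(q, n)\<leftarrow>qs. of_rat q *\<^sub>R u n)
      = (\<Sum>(q, n)\<leftarrow>map (\<lambda>(q, n). (r * q, n)) qs. of_rat q *\<^sub>R u n)"
    by (induction qs) (auto simp: scaleR_add_right of_rat_mult)
  then show ?thesis
    unfolding rational_span_def x by blast
qed

lemma rational_span_diff: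
  assumes "x \<in> rational_span u" "y \<in> rational_span u"
  shows "x - y \<in> rational_span u"
  using rational_span_add[OF assms(1) rational_span_scale[OF assms(2), of "-1"]]
  by (simp add: of_rat_minus)

text \<open>If \<open>x\<close> almost attains the norm of \<open>f\<close> on \<open>rational_span u\<close>, then smoothness makes \<open>f h\<close>
  almost equal to \<open>s * (norm (x + h) - norm x)\<close> with \<open>s\<close> that norm. Hence convergence of
  \<open>norm (x + u n)\<close> on a countable set of \<open>x\<close> controls every functional.\<close>

lemma functional_Cauchy_of_norms:
  fixes u :: "nat \<Rightarrow> 'a::real_normed_vector" and f :: "'a \<Rightarrow> real"
  assumes us: "uniformly_smooth TYPE('a)" and M: "\<And>n. norm (u n) \<le> M"
    and f: "bounded_linear f"
    and plus: "\<And>x. x \<in> rational_span u \<Longrightarrow> Cauchy (\<lambda>n. norm (x + u n))"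
  shows "Cauchy (\<lambda>n. f (u n))"
proof -
  interpret f: bounded_linear f by (rule f)
  define V where "V = rational_span u"
  obtain K where K: "\<And>x. \<bar>f x\<bar> \<le> norm x * K" "0 < K"
    using f.pos_bounded by (auto simp: real_norm_def)
  \<comment> \<open>\<open>s\<close> is the norm of \<open>f\<close> on \<open>V\<close> alone; the
    vector 0 contributes \<open>0 / 0 = 0\<close>. If \<open>s\<close> is not positive,
    \<open>f\<close> vanishes at every \<open>u n\<close>.\<close>
  define s where "s = Sup ((\<lambda>x. f x / norm x) ` V)"
  have bdd: "bdd_above ((\<lambda>x. f x / norm x) ` V)"
  proof (rule bdd_aboveI2)
    show "f x / norm x \<le> K" for x
      using K(1)[of x] K(2) by (cases "x = 0") (auto simp: divide_simps abs_le_iff mult.commute)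
  qed
  have fs: "f x \<le> s * norm x" if "x \<in> V" for x
  proof (cases "x = 0")
    case False
    have "f x / norm x \<le> s" unfolding s_def using that bdd by (intro cSup_upper) auto
    then show ?thesis using False by (simp add: divide_simps)
  qed (simp add: f.zero)
  have uV: "u n \<in> V" for n using rational_span_base by (simp add: V_def)
  have V_neg: "- x \<in> V" if "x \<in> V" for x
    using rational_span_scale[of x u "-1"] that by (simp add: V_def of_rat_minus)
  have M0: "0 \<le> M" using M[of 0] norm_ge_zero order_trans by blast
  have fabs: "\<bar>f x\<bar> \<le> s * norm x" if "x \<in> V" for x
    using fs[OF that] fs[OF V_neg[OF that]] by (simp add: f.neg abs_le_iff)
  show ?thesis
  proof (cases "0 < s")
    case False
    have "f (u n) = 0" for n
      using fabs[OF uV, of n] False mult_nonpos_nonneg[of s "norm (u n)"] by auto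
    then show ?thesis by (simp add: LIMSEQ_imp_Cauchy[OF tendsto_const])
  next
    case True
    show ?thesis
    proof (rule CauchyI)
      fix e :: real assume e: "0 < e"
      define M' where "M' = M + 1"
      have M': "0 < M'" "\<And>n. norm (u n) \<le> M'"
        using M M0 by (auto simp: M'_def intro: order_trans add_increasing2)
      \<comment> \<open>Chosen so that \<open>s * \<epsilon> * M' = e / 8\<close>. Two errors
        \<open>3 * (e / 8)\<close> from \<open>near\<close> and a Cauchy error below
        \<open>e / 4\<close> then add up to less than \<open>e\<close>.\<close>
      define \<epsilon> where "\<epsilon> = e / (8 * s * M')"
      have \<epsilon>: "0 < \<epsilon>" using e True M' by (simp add: \<epsilon>_def)
      obtain \<delta> where \<delta>: "0 < \<delta>" and sm: "\<And>x h :: 'a. norm h \<le> \<delta> * norm x \<Longrightarrow>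
          norm (x + h) + norm (x - h) \<le> 2 * norm x + 2 * \<epsilon> * norm h"
        using uniformly_smoothD[OF us \<epsilon>] by metis
      \<comment> \<open>The first entry turns \<open>\<delta> * norm x \<le> 2 * M'\<close> into
        \<open>\<eta> * norm x \<le> \<epsilon> * M'\<close>; the second keeps
        \<open>1 - \<eta>\<close> positive.\<close>
      define \<eta> where "\<eta> = min (\<epsilon> * \<delta> / 2) (1/2)"
      have \<eta>: "0 < \<eta>" "\<eta> \<le> \<epsilon> * \<delta> / 2" "\<eta> < 1" using \<epsilon> \<delta> by (auto simp: \<eta>_def)
      have "s * (1 - \<eta>) < s" using True \<eta> by simp
      then obtain z where z: "z \<in> V" "s * (1 - \<eta>) < f z / norm z"
        using less_cSup_iff[OF _ bdd, of "s * (1 - \<eta>)"] uV unfolding s_def by blast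
      moreover have "0 < s * (1 - \<eta>)" using True \<eta> by simp
      ultimately have "0 < f z / norm z" by linarith
      then have z0: "z \<noteq> 0" by (auto simp: f.zero)
      have fz: "s * (1 - \<eta>) * norm z \<le> f z" using z z0 by (simp add: divide_simps)
      \<comment> \<open>The rational factor \<open>q\<close> puts \<open>\<delta> * norm x\<close>
        between \<open>M'\<close> and \<open>2 * M'\<close>: large enough for every
        \<open>u n\<close> to be an admissible perturbation of \<open>x\<close>, small enough for
        the norming defect of \<open>x\<close> to stay negligible.\<close>
      have "M' / (\<delta> * norm z) < 2 * M' / (\<delta> * norm z)" 
        using M' \<delta> z0 by (intro divide_strict_right_mono) auto
      then obtain q where q: "M' / (\<delta> * norm z) < of_rat q" "of_rat q < 2 * M' / (\<delta> * norm z)"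
        using of_rat_dense by blast
      have q0: "0 < (of_rat q :: real)"
        using q(1) M' \<delta> z0 by (meson divide_pos_pos less_trans mult_pos_pos zero_less_norm_iff)
      define x where "x = of_rat q *\<^sub>R z"
      have xV: "x \<in> V" using z(1) rational_span_scale unfolding x_def V_def by blast
      have nx: "norm x = of_rat q * norm z" using q0 by (simp add: x_def)
      have x1: "M' \<le> \<delta> * norm x" and x2: "\<delta> * norm x \<le> 2 * M'"
        using q \<delta> z0 by (simp_all add: nx divide_simps mult_ac less_imp_le)
      have "of_rat q * (s * (1 - \<eta>) * norm z) \<le> of_rat q * f z"
        using fz q0 by (intro mult_left_mono) auto
      then have fx: "s * (1 - \<eta>) * norm x \<le> f x"
        unfolding nx by (simp add: x_def f.scaleR mult_ac del: norm_scaleR)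
      have "\<eta> * norm x \<le> \<epsilon> * \<delta> / 2 * norm x" using \<eta> by (intro mult_right_mono) auto
      also have "\<dots> = \<epsilon> / 2 * (\<delta> * norm x)" by simp
      also have "\<dots> \<le> \<epsilon> / 2 * (2 * M')" using x2 \<epsilon> by (intro mult_left_mono) auto
      finally have \<eta>x: "\<eta> * norm x \<le> \<epsilon> * M'" by simp
      define a b where "a n = norm (x + u n)" and "b n = norm (x - u n)" for n
      \<comment> \<open>Testing \<open>f\<close> on \<open>x + u n\<close> bounds
        \<open>f (u n)\<close> from above, testing it on \<open>x - u n\<close> bounds it from
        below. Smoothness then says that the two bounds almost agree.\<close>
      have est: "s * (norm x - b n) - s * \<epsilon> * M' \<le> f (u n)"
                "f (u n) \<le> s * (a n - norm x) + s * \<epsilon> * M'" for n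
      proof -
        have e1: "s * (\<eta> * norm x) \<le> s * (\<epsilon> * M')"
          using \<eta>x True by (intro mult_left_mono) auto
        have "x + u n \<in> V" "x - u n \<in> V"
          using xV uV rational_span_add rational_span_diff unfolding V_def by blast+
        then have "f (x + u n) \<le> s * a n" "f (x - u n) \<le> s * b n"
          using fs unfolding a_def b_def by blast+
        then show "s * (norm x - b n) - s * \<epsilon> * M' \<le> f (u n)"
                "f (u n) \<le> s * (a n - norm x) + s * \<epsilon> * M'"
          using fx e1 by (simp_all add: f.add f.diff algebra_simps)
      qed
      have smooth: "s * (a n + b n - 2 * norm x) \<le> s * (2 * \<epsilon> * M')" for n
      proof (rule mult_left_mono)
        have "a n + b n \<le> 2 * norm x + 2 * \<epsilon> * norm (u n)"
          unfolding a_def b_def using M'(2)[of n] x1 by (intro sm) linarith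
        moreover have "2 * \<epsilon> * norm (u n) \<le> 2 * \<epsilon> * M'"
          using M'(2)[of n] \<epsilon> by (intro mult_left_mono) auto
        ultimately show "a n + b n - 2 * norm x \<le> 2 * \<epsilon> * M'" by linarith
      qed (use True in simp)
      have sM: "s * \<epsilon> * M' = e / 8" using True M' by (simp add: \<epsilon>_def)
      have near: "\<bar>f (u n) - s * (a n - norm x)\<bar> \<le> 3 * (e / 8)" for n
      proof -
        have "s * (2 * \<epsilon> * M') = 2 * (e / 8)" using sM by simp
        then show ?thesis
          using smooth[of n] est[of n] e unfolding sM right_diff_distrib distrib_left by linarith
      qed
      obtain N where N: "\<And>m n. \<lbrakk>m \<ge> N; n \<ge> N\<rbrakk> \<Longrightarrow> \<bar>a m - a n\<bar> < e / (4 * s)"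
        using CauchyD[OF plus[OF xV[unfolded V_def]], of "e / (4 * s)"] e True
        unfolding a_def by (auto simp: real_norm_def)
      have "norm (f (u m) - f (u n)) < e" if "m \<ge> N" "n \<ge> N" for m n
      proof -
        have "s * \<bar>a m - a n\<bar> < s * (e / (4 * s))" using N[OF that] True by (intro mult_strict_left_mono) auto
        then have "s * \<bar>a m - a n\<bar> < e / 4" using True by simp
        moreover have "s * \<bar>a m - a n\<bar> = \<bar>s * (a m - norm x) - s * (a n - norm x)\<bar>"
          using True by (simp add: abs_mult flip: right_diff_distrib)
        ultimately show ?thesis using near[of m] near[of n] unfolding real_norm_def by linarith
      qed
      then show "\<exists>N. \<forall>m\<ge>N. \<forall>n\<ge>N. norm (f (u m) - f (u n)) < e" by blast
    qed
  qed
qed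

text \<open>The extraction makes all norms \<open>norm (x + v n)\<close> with \<open>x\<close> in
  the span converge, smoothness passes this on to every functional, and the tail hulls supply the
  point at which the limits are attained.\<close>

lemma weakly_convergent_subsequence:
  fixes u :: "nat \<Rightarrow> 'a::banach"
  assumes uc: "uniformly_convex TYPE('a)" and us: "uniformly_smooth TYPE('a)"
    and M: "\<And>n. norm (u n) \<le> M"
  obtains r l where "strict_mono r" "converges_weakly (u \<circ> r) l"
proof -
  obtain r :: "nat \<Rightarrow> nat" where r: "strict_mono r"
    "\<And>x. x \<in> rational_span u \<Longrightarrow> \<exists>l. (\<lambda>n. norm (x + u (r n)) - norm x) \<longlonglongrightarrow> l"
  \<comment> \<open>Subtracting \<open>norm x\<close> gives a bound \<open>M\<close> that is uniform
    in \<open>x\<close>, as the extraction requires.\<close>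
  proof (rule function_convergent_subsequence[of "rational_span u" "\<lambda>n x. norm (x + u n) - norm x" M])
    show "norm (norm (x + u n) - norm x) \<le> M" for n x
      using norm_triangle_ineq3[of "x + u n" x] M[of n] by simp
  qed (use countable_rational_span in auto)
  define v where "v = u \<circ> r"
  have vM: "norm (v n) \<le> M" for n using M by (simp add: v_def)
  have V: "rational_span v \<subseteq> rational_span u"
  proof
    fix x assume "x \<in> rational_span v"
    then obtain qs :: "(rat \<times> nat) list" where "x = (\<Sum>(q, n)\<leftarrow>qs. of_rat q *\<^sub>R v n)"
      unfolding rational_span_def by blast
    then have "x = (\<Sum>(q, n)\<leftarrow>map (\<lambda>(q, n). (q, r n)) qs. of_rat q *\<^sub>R u n)"
      by (simp add: v_def o_def split_def)
    then show "x \<in> rational_span u" unfolding rational_span_def by blast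
  qed
  have conv: "Cauchy (\<lambda>n. norm (x + v n))" if x: "x \<in> rational_span v" for x
  proof -
    obtain l where "(\<lambda>n. norm (x + u (r n)) - norm x) \<longlonglongrightarrow> l" using x V r(2) by blast
    then have "(\<lambda>n. norm (x + u (r n)) - norm x + norm x) \<longlonglongrightarrow> l + norm x"
      by (intro tendsto_intros)
    then show ?thesis by (simp add: v_def LIMSEQ_imp_Cauchy)
  qed
  obtain x l where xl: "\<And>n. x n \<in> convex hull (v ` {n..})" "x \<longlonglongrightarrow> l"
    using tail_hulls_convergent[OF uc, of v M] vM by metis
  have "(\<lambda>n. f (v n)) \<longlonglongrightarrow> f l" if f: "bounded_linear f" for f :: "'a \<Rightarrow> real"
  proof -
    have "Cauchy (\<lambda>n. f (v n))" using functional_Cauchy_of_norms[OF us vM f conv] .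
    then obtain c where c: "(\<lambda>n. f (v n)) \<longlonglongrightarrow> c" using Cauchy_convergent_iff convergent_def by blast
    then show ?thesis using tail_hulls_weak_limit[OF xl f c] by simp
  qed
  then have "converges_weakly v l" unfolding converges_weakly_def by blast
  then show thesis using that r(1) unfolding v_def by blast
qed

section \<open>Norming functionals and the Kadec--Klee property\<close>

text \<open>The one-sided directional derivative of the norm at \<open>y\<close> is sublinear, and smoothness makes it
  odd. This replaces the Hahn--Banach theorem.\<close>

lemma norming_functional:
  fixes y :: "'a::real_normed_vector"
  assumes us: "uniformly_smooth TYPE('a)"
  obtains g :: "'a \<Rightarrow> real" where "bounded_linear g" "g y = norm y" "\<And>h. g h \<le> norm h"
proof (cases "y = 0")
  case True
  then show thesis by (intro that[of "\<lambda>_. 0"]) (auto simp: bounded_linear_zero)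
next
  case y: False
  \<comment> \<open>By convexity of the norm the quotient is monotone in \<open>t\<close>, so the
    infimum \<open>L h\<close> is its limit as \<open>t\<close> decreases to 0.\<close>
  define q where "q t h = (norm (y + t *\<^sub>R h) - norm y) / t" for t h
  define L where "L h = Inf ((\<lambda>t. q t h) ` {0<..})" for h
  have q_le: "q t h \<le> norm h" if "0 < t" for t h
    using norm_triangle_ineq[of y "t *\<^sub>R h"] that by (simp add: q_def divide_simps mult.commute)
  have q_ge: "- norm h \<le> q t h" if "0 < t" for t h
    using norm_triangle_ineq4[of "y + t *\<^sub>R h" "t *\<^sub>R h"] that by (simp add: q_def field_simps)
  have q_mono: "q s h \<le> q t h" if "0 < s" "s \<le> t" for s t h
  proof -
    have "y + s *\<^sub>R h = (1 - s / t) *\<^sub>R y + (s / t) *\<^sub>R (y + t *\<^sub>R h)"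
      using that by (simp add: algebra_simps)
    then have "norm (y + s *\<^sub>R h) \<le> norm ((1 - s / t) *\<^sub>R y) + norm ((s / t) *\<^sub>R (y + t *\<^sub>R h))"
      by (metis norm_triangle_ineq)
    also have "\<dots> = (1 - s / t) * norm y + s / t * norm (y + t *\<^sub>R h)"
      using that by simp
    finally have "norm (y + s *\<^sub>R h) - norm y \<le> s * q t h"
      using that by (simp add: q_def algebra_simps diff_divide_distrib)
    then show ?thesis using that by (simp add: q_def[of s] divide_simps mult.commute)
  qed
  have bdd: "bdd_below ((\<lambda>t. q t h) ` {0<..})" for h
    using q_ge by (intro bdd_belowI2[of _ "- norm h"]) auto
  have L_le: "L h \<le> q t h" if "0 < t" for t h
    unfolding L_def using that bdd by (intro cInf_lower) auto
  have L_ge: "c \<le> L h" if "\<And>t. 0 < t \<Longrightarrow> c \<le> q t h" for c h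
    unfolding L_def using that by (intro cInf_greatest) (auto intro: exI[of _ 1])
  have L_approx: "\<exists>t0>0. \<forall>t. 0 < t \<longrightarrow> t \<le> t0 \<longrightarrow> q t h < L h + e" if "0 < e" for h e
  proof -
    have "\<exists>t0>0. q t0 h < L h + e"
      using cInf_less_iff[OF _ bdd[of h], of "L h + e"] that unfolding L_def by auto
    then show ?thesis using q_mono by (meson order_le_less_trans)
  qed
  have L_sub: "L (h + k) \<le> L h + L k" for h k
  proof (rule field_le_epsilon)
    fix e :: real assume "0 < e"
    then obtain t0 t1 where t: "0 < t0" "\<And>t. 0 < t \<Longrightarrow> t \<le> t0 \<Longrightarrow> q t h < L h + e / 2"
      "0 < t1" "\<And>t. 0 < t \<Longrightarrow> t \<le> t1 \<Longrightarrow> q t k < L k + e / 2"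
      using L_approx[of "e / 2"] by (metis half_gt_zero)
    define t where "t = min t0 t1"
    have t0: "0 < t" using t by (simp add: t_def)
    have "2 *\<^sub>R (y + (t / 2) *\<^sub>R (h + k)) = (y + t *\<^sub>R h) + (y + t *\<^sub>R k)"
      by (simp add: algebra_simps scaleR_2)
    then have "norm (2 *\<^sub>R (y + (t / 2) *\<^sub>R (h + k))) \<le> norm (y + t *\<^sub>R h) + norm (y + t *\<^sub>R k)"
      by (metis norm_triangle_ineq)
    then have "2 * norm (y + (t / 2) *\<^sub>R (h + k)) \<le> norm (y + t *\<^sub>R h) + norm (y + t *\<^sub>R k)"
      by (simp only: norm_scaleR abs_numeral)
    then have "(norm (y + (t / 2) *\<^sub>R (h + k)) - norm y) * 2 / t
        \<le> (norm (y + t *\<^sub>R h) - norm y + (norm (y + t *\<^sub>R k) - norm y)) / t"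
      using t0 by (intro divide_right_mono) auto
    then have "q (t / 2) (h + k) \<le> q t h + q t k"
      unfolding q_def add_divide_distrib by simp
    moreover have "L (h + k) \<le> q (t / 2) (h + k)" using t0 by (intro L_le) auto
    moreover have "q t h < L h + e / 2" "q t k < L k + e / 2"
      using t t0 by (auto simp: t_def)
    ultimately show "L (h + k) \<le> L h + L k + e" by linarith
  qed
  have L0: "L 0 = 0"
    using L_le[of 1 0] L_ge[of 0 0] by (force simp: q_def)
  have L_odd_le: "L h + L (- h) \<le> 0" for h
  proof (rule field_le_epsilon)
    fix e :: real assume e: "0 < e"
    \<comment> \<open>Adding 1 avoids a division by zero for \<open>h = 0\<close>; with
      \<open>\<epsilon> = e / (2 * k)\<close> the smoothness error
      \<open>2 * \<epsilon> * norm h\<close> is at most \<open>e\<close>.\<close>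
    define k where "k = norm h + 1"
    have n1: "0 < k" "norm h \<le> k" by (simp_all add: k_def add_nonneg_pos)
    define \<epsilon> where "\<epsilon> = e / (2 * k)"
    have \<epsilon>: "0 < \<epsilon>" using e n1 by (simp add: \<epsilon>_def)
    obtain \<delta> where \<delta>: "0 < \<delta>" and sm: "\<And>x h :: 'a. norm h \<le> \<delta> * norm x \<Longrightarrow>
        norm (x + h) + norm (x - h) \<le> 2 * norm x + 2 * \<epsilon> * norm h"
      using uniformly_smoothD[OF us \<epsilon>] by metis
    define t where "t = \<delta> * norm y / k"
    have t: "0 < t" using \<delta> y n1 by (simp add: t_def)
    have "t * norm h \<le> t * k" using t by (intro mult_left_mono) (use n1 in auto)
    also have "\<dots> = \<delta> * norm y" using n1 by (simp add: t_def)
    finally have "norm (t *\<^sub>R h) \<le> \<delta> * norm y" using t by simp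
    from sm[OF this] have "norm (y + t *\<^sub>R h) + norm (y - t *\<^sub>R h) - 2 * norm y \<le> t * (2 * \<epsilon> * norm h)"
      using t by (simp add: mult_ac)
    then have "(norm (y + t *\<^sub>R h) - norm y + (norm (y - t *\<^sub>R h) - norm y)) / t
        \<le> t * (2 * \<epsilon> * norm h) / t"
      using t by (intro divide_right_mono) auto
    then have "q t h + q t (- h) \<le> 2 * \<epsilon> * norm h"
      unfolding q_def add_divide_distrib using t by simp
    also have "\<dots> \<le> 2 * \<epsilon> * k" using \<epsilon> n1 by (intro mult_left_mono) auto
    also have "\<dots> = e" using n1 by (simp add: \<epsilon>_def)
    finally show "L h + L (- h) \<le> 0 + e"
      using L_le[OF t, of h] L_le[OF t, of "- h"] by linarith
  qed
  have L_neg: "L (- h) = - L h" for h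
    using L_odd_le[of h] L_sub[of h "- h"] L0 by simp
  have L_add: "L (h + k) = L h + L k" for h k
    using L_sub[of h k] L_sub[of "h + k" "- k"] L_neg[of k] by simp
  have L_scale_le: "L (c *\<^sub>R h) \<le> c * L h" if "0 < c" for c h
  proof -
    have "L (c *\<^sub>R h) / c \<le> L h"
    proof (rule L_ge)
      fix t :: real assume "0 < t"
      then have "L (c *\<^sub>R h) \<le> q (t / c) (c *\<^sub>R h)" using that by (intro L_le) auto
      also have "\<dots> = c * q t h" using that \<open>0 < t\<close> by (simp add: q_def)
      finally show "L (c *\<^sub>R h) / c \<le> q t h" using that by (simp add: divide_simps mult.commute)
    qed
    then show ?thesis using that by (simp add: divide_simps mult.commute)
  qed
  have L_scale_pos: "L (c *\<^sub>R h) = c * L h" if "0 < c" for c h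
    using L_scale_le[OF that, of h] L_scale_le[of "1 / c" "c *\<^sub>R h"] that
    by (simp add: divide_simps mult.commute)
  have L_scale: "L (c *\<^sub>R h) = c * L h" for c h
    using L_scale_pos[of c h] L_scale_pos[of "- c" h] L_neg[of "c *\<^sub>R h"] L0
    by (cases "c = 0"; cases "0 < c") auto
  have L_le_norm: "L h \<le> norm h" for h using L_le[of 1 h] q_le[of 1 h] by simp
  have "\<bar>L h\<bar> \<le> norm h" for h
    using L_le_norm[of h] L_le_norm[of "- h"] L_neg[of h] by simp
  then have "bounded_linear L"
    using L_add L_scale by (intro bounded_linear_intro[of _ 1]) auto
  \<comment> \<open>In the direction \<open>y\<close> itself every quotient equals
    \<open>norm y\<close>.\<close>
  moreover have "norm y \<le> L y"
  proof (rule L_ge)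
    fix t :: real assume t: "0 < t"
    have "y + t *\<^sub>R y = (1 + t) *\<^sub>R y" by (simp add: algebra_simps)
    then have "norm (y + t *\<^sub>R y) = (1 + t) * norm y" using t by simp
    then show "norm y \<le> q t y" using t by (simp add: q_def field_simps)
  qed
  ultimately show thesis using L_le_norm by (intro that[of L]) (auto intro: antisym)
qed

text \<open>A functional \<open>g\<close> norming \<open>y\<close> satisfies
  \<open>g (Y n) \<le> norm (Y n)\<close>, while \<open>g (Y n)\<close> tends to
  \<open>norm y\<close>. The eventual form is the lower half of an order limit, which is how it is
  consumed later.\<close>

lemma norm_weak_lower_semicontinuous:
  fixes y :: "'a::real_normed_vector"
  assumes us: "uniformly_smooth TYPE('a)" and w: "converges_weakly Y y" and c: "c < norm y"
  shows "\<forall>\<^sub>F n in sequentially. c < norm (Y n)"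
proof -
  obtain g where g: "bounded_linear g" "g y = norm y" "\<And>h. g h \<le> norm h"
    using norming_functional[OF us, of y] by blast
  have "(\<lambda>n. g (Y n)) \<longlonglongrightarrow> norm y" using w g(1,2) unfolding converges_weakly_def by metis
  then have "\<forall>\<^sub>F n in sequentially. c < g (Y n)" using c by (rule order_tendstoD(1))
  then show ?thesis by eventually_elim (use g(3) order_less_le_trans in blast)
qed

text \<open>The midpoints of \<open>Y n\<close> and \<open>y\<close> also converge weakly to
  \<open>y\<close>, so their norms cannot drop below \<open>norm y\<close> in the limit. Since
  \<open>norm (Y n)\<close> does not exceed \<open>norm y\<close> in the limit either, uniform
  convexity forces \<open>Y n\<close> towards \<open>y\<close>.\<close>

lemma Kadec_Klee:
  fixes y :: "'a::real_normed_vector"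
  assumes uc: "uniformly_convex TYPE('a)" and us: "uniformly_smooth TYPE('a)"
    and w: "converges_weakly Y y" and n: "(\<lambda>n. norm (Y n)) \<longlonglongrightarrow> norm y"
  shows "Y \<longlonglongrightarrow> y"
proof (rule tendstoI)
  fix e :: real assume e: "0 < e"
  obtain \<eta> where \<eta>: "0 < \<eta>"
    and close: "\<And>a b :: 'a. \<lbrakk>norm a \<le> norm y + \<eta>; norm b \<le> norm y + \<eta>;
      norm y - \<eta> \<le> norm ((a + b) /\<^sub>R 2)\<rbrakk> \<Longrightarrow> norm (a - b) < e"
    using uniformly_convexD[OF uc norm_ge_zero[of y] e] by metis
  have "converges_weakly (\<lambda>n. (Y n + y) /\<^sub>R 2) y"
    unfolding converges_weakly_def
  proof (intro allI impI)
    fix f :: "'a \<Rightarrow> real" assume f: "bounded_linear f"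
    interpret f: bounded_linear f by (rule f)
    have "(\<lambda>n. (f (Y n) + f y) / 2) \<longlonglongrightarrow> (f y + f y) / 2"
      using w f unfolding converges_weakly_def by (intro tendsto_intros) auto
    moreover have "(\<lambda>n. f ((Y n + y) /\<^sub>R 2)) = (\<lambda>n. (f (Y n) + f y) / 2)"
      unfolding f.scaleR f.add by simp
    ultimately show "(\<lambda>n. f ((Y n + y) /\<^sub>R 2)) \<longlonglongrightarrow> f y" by simp
  qed
  then have "\<forall>\<^sub>F n in sequentially. norm y - \<eta> < norm ((Y n + y) /\<^sub>R 2)"
    using \<eta> by (intro norm_weak_lower_semicontinuous[OF us]) auto
  moreover have "\<forall>\<^sub>F n in sequentially. norm (Y n) < norm y + \<eta>"
    using n \<eta> by (intro order_tendstoD) auto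
  ultimately show "\<forall>\<^sub>F n in sequentially. dist (Y n) y < e"
    by eventually_elim (use close \<eta> in \<open>auto simp: dist_norm\<close>)
qed

section \<open>Convexity of sets with a continuous metric projection\<close>

text \<open>The norm of a product type is the Euclidean combination of the two norms, so another
  norm has to be an explicit functional \<open>N\<close>. Topology and completeness come from the
  type, smoothness and distances from \<open>N\<close>; the constants \<open>c\<close> and
  \<open>C\<close> mediate.\<close>

locale smooth_equivalent_norm =
  fixes N :: "'a::banach \<Rightarrow> real" and c C :: real
  assumes triangle: "N (x + y) \<le> N x + N y"
    and scale: "N (r *\<^sub>R x) = \<bar>r\<bar> * N x"
    and c_pos: "0 < c" and lower: "c * norm x \<le> N x" and upper: "N x \<le> C * norm x"
    and smooth: "0 < \<epsilon> \<Longrightarrow> \<exists>\<delta>>0. \<forall>x y. N x = 1 \<longrightarrow> N y \<le> \<delta> \<longrightarrow> N (x + y) + N (x - y) \<le> 2 + \<epsilon> * N y"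
begin

lemma N_minus: "N (- x) = N x"
  using scale[of "-1" x] by simp

lemma N_minus_commute: "N (x - y) = N (y - x)"
  using N_minus[of "x - y"] by simp

lemma N_nonneg: "0 \<le> N x"
  using lower[of x] c_pos by (meson mult_nonneg_nonneg norm_ge_zero order_trans less_imp_le)

lemma N_zero: "N 0 = 0"
  using scale[of 0 0] by simp

lemma N_eq_zero: "N x = 0 \<Longrightarrow> x = 0"
  using lower[of x] c_pos by (simp add: mult_le_0_iff)

lemma triangle_diff: "N (x - z) \<le> N (x - y) + N (y - z)"
  using triangle[of "x - y" "y - z"] by simp

lemma tendsto_N:
  assumes "(f \<longlongrightarrow> l) F"
  shows "((\<lambda>x. N (f x)) \<longlongrightarrow> N l) F"
proof (rule LIM_zero_cancel, rule Lim_null_comparison)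
  have "\<bar>N (f x) - N l\<bar> \<le> C * norm (f x - l)" for x
    using triangle[of "f x - l" l] triangle_diff[of l 0 "f x"] N_minus_commute[of l "f x"]
      upper[of "f x - l"] by (simp add: abs_le_iff)
  then show "\<forall>\<^sub>F x in F. norm (N (f x) - N l) \<le> C * norm (f x - l)" by simp
  have "((\<lambda>x. C * norm (f x - l)) \<longlongrightarrow> C * norm (l - l)) F"
    by (intro tendsto_intros assms)
  then show "((\<lambda>x. C * norm (f x - l)) \<longlongrightarrow> 0) F" by simp
qed

end

locale continuous_projection = smooth_equivalent_norm N c C
  for N :: "'a::banach \<Rightarrow> real" and c C +
  fixes K :: "'a set" and P :: "'a \<Rightarrow> 'a"
  assumes P_mem: "P x \<in> K"
    and P_min: "k \<in> K \<Longrightarrow> N (x - P x) \<le> N (x - k)"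
    and P_cont: "isCont P x"
begin

definition d :: "'a \<Rightarrow> real" where "d x = N (x - P x)"

lemma d_le: "k \<in> K \<Longrightarrow> d x \<le> N (x - k)"
  unfolding d_def by (rule P_min)

lemma d_Lipschitz: "d x \<le> d y + N (x - y)"
  using d_le[OF P_mem, of x y] triangle_diff[of x "P y" y] unfolding d_def by linarith

lemma tendsto_P: "(f \<longlongrightarrow> l) F \<Longrightarrow> ((\<lambda>x. P (f x)) \<longlongrightarrow> P l) F"
  using P_cont by (rule isCont_tendsto_compose)

lemma tendsto_d: "(f \<longlongrightarrow> l) F \<Longrightarrow> ((\<lambda>x. d (f x)) \<longlongrightarrow> d l) F"
  unfolding d_def by (intro tendsto_N tendsto_diff tendsto_P)

lemma d_zero: "d x = 0 \<Longrightarrow> x \<in> K"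
  using N_eq_zero[of "x - P x"] P_mem[of x] by (simp add: d_def)

text \<open>Moving from \<open>x\<close> straight away from \<open>P x\<close> increases the distance to \<open>K\<close> at almost unit rate,
  because the projection hardly moves.\<close>

lemma distance_ascent:
  assumes x: "0 < d x" and \<sigma>: "\<sigma> < 1" and e: "0 < e"
  obtains z where "z \<noteq> x" "N (z - x) \<le> e" "d x + \<sigma> * N (z - x) \<le> d z"
proof -
  define z where "z t = x + t *\<^sub>R (x - P x)" for t :: real
  have "(z \<longlongrightarrow> x + 0 *\<^sub>R (x - P x)) (at_right 0)"
    unfolding z_def by (intro tendsto_intros)
  then have "((\<lambda>t. N (P x - P (z t))) \<longlongrightarrow> N (P x - P x)) (at_right 0)"
    by (intro tendsto_N tendsto_diff tendsto_P tendsto_const) simp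
  then have "\<forall>\<^sub>F t in at_right 0. N (P x - P (z t)) < (1 - \<sigma>) * d x"
    using x \<sigma> by (intro order_tendstoD(2)) (auto simp: N_zero)
  moreover have "\<forall>\<^sub>F t in at_right 0. t \<in> {0<..<e / d x}"
    using x e by (intro eventually_at_right_real) simp
  ultimately have "\<forall>\<^sub>F t in at_right 0. N (P x - P (z t)) < (1 - \<sigma>) * d x \<and> t \<in> {0<..<e / d x}"
    by (rule eventually_conj)
  then obtain t where t: "N (P x - P (z t)) < (1 - \<sigma>) * d x" "0 < t" "t < e / d x"
    using eventually_happens'[OF trivial_limit_at_right_real] by fastforce
  have zx: "N (z t - x) = t * d x"
    using t(2) by (simp add: z_def scale d_def)
  \<comment> \<open>The left side has \<open>N\<close> at least \<open>(1 + t) * d x\<close>, since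
    \<open>P (z t)\<close> lies in \<open>K\<close>. The correction on the right is \<open>t\<close>
    times the displacement of the projection and costs at most
    \<open>t * ((1 - \<sigma>) * d x)\<close>.\<close>
  have "(1 + t) *\<^sub>R (x - P (z t)) = (z t - P (z t)) + t *\<^sub>R (P x - P (z t))"
    by (simp add: z_def algebra_simps)
  then have "(1 + t) * N (x - P (z t)) \<le> d (z t) + t * N (P x - P (z t))"
    using triangle[of "z t - P (z t)" "t *\<^sub>R (P x - P (z t))"] t(2) scale[of "1 + t" "x - P (z t)"]
    by (simp add: scale d_def)
  moreover have "(1 + t) * d x \<le> (1 + t) * N (x - P (z t))"
    using d_le[OF P_mem] t(2) by (intro mult_left_mono) auto
  moreover have "t * N (P x - P (z t)) \<le> t * ((1 - \<sigma>) * d x)"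
    using t by (intro mult_left_mono) auto
  ultimately have "(1 + t) * d x \<le> d (z t) + t * ((1 - \<sigma>) * d x)" by linarith
  then have "d x + \<sigma> * N (z t - x) \<le> d (z t)"
    unfolding zx by (simp add: algebra_simps)
  moreover have "0 < N (z t - x)" unfolding zx using t x by simp
  then have "z t \<noteq> x" using N_zero by auto
  moreover have "N (z t - x) \<le> e"
    unfolding zx using t x by (simp add: pos_less_divide_eq less_imp_le)
  ultimately show thesis by (intro that)
qed

text \<open>Ekeland's argument: a maximal element of the ordering \<open>d z + \<sigma> * N (w - z) \<le> d w\<close> within the
  ball of radius \<open>R\<close> around \<open>x\<close> must lie on its boundary.\<close>

lemma far_distance_ascent:
  assumes x: "0 < d x" and \<sigma>: "0 < \<sigma>" "\<sigma> < 1" and R: "0 < R"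
  obtains z where "N (z - x) = R" "d x + \<sigma> * R \<le> d z"
proof -
  define A where "A z = {w. N (w - x) \<le> R \<and> d z + \<sigma> * N (w - z) \<le> d w}" for z
  have A_refl: "z \<in> A z" if "N (z - x) \<le> R" for z
    using that by (simp add: A_def N_zero)
  have A_trans: "A w \<subseteq> A z" if "w \<in> A z" for w z
  proof
    fix v assume v: "v \<in> A w"
    have "\<sigma> * N (v - z) \<le> \<sigma> * (N (v - w) + N (w - z))"
      using triangle_diff \<sigma> by (intro mult_left_mono) auto
    then show "v \<in> A z" using v that by (simp add: A_def distrib_left)
  qed
  have A_closed: "l \<in> A z" if "\<forall>\<^sub>F n in sequentially. w n \<in> A z" "w \<longlonglongrightarrow> l" for w l z
  proof -
    have "N (l - x) \<le> R"
    proof (rule tendsto_upperbound)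
      show "(\<lambda>n. N (w n - x)) \<longlonglongrightarrow> N (l - x)" using that by (intro tendsto_N tendsto_intros)
      show "\<forall>\<^sub>F n in sequentially. N (w n - x) \<le> R"
        using that(1) by eventually_elim (simp add: A_def)
    qed simp
    moreover have "d z + \<sigma> * N (l - z) \<le> d l"
    proof (rule tendsto_le)
      show "(\<lambda>n. d (w n)) \<longlonglongrightarrow> d l" using that by (intro tendsto_d)
      show "(\<lambda>n. d z + \<sigma> * N (w n - z)) \<longlonglongrightarrow> d z + \<sigma> * N (l - z)"
        using that by (intro tendsto_N tendsto_intros)
      show "\<forall>\<^sub>F n in sequentially. d z + \<sigma> * N (w n - z) \<le> d (w n)"
        using that(1) by eventually_elim (simp add: A_def)
    qed simp
    ultimately show ?thesis by (simp add: A_def)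
  qed
  have step: "\<exists>z'\<in>A z. \<forall>w\<in>A z. d w \<le> d z' + (1/2) ^ n" if zR: "N (z - x) \<le> R" for z and n :: nat
  proof -
    have "d w \<le> d x + R" if "w \<in> A z" for w
      using that d_Lipschitz[of w x] by (simp add: A_def)
    then have bdd: "bdd_above (d ` A z)" by (intro bdd_aboveI2)
    have "Sup (d ` A z) - (1/2) ^ n < Sup (d ` A z)" by simp
    then obtain z' where "z' \<in> A z" "Sup (d ` A z) - (1/2) ^ n < d z'"
      using less_cSup_iff[OF _ bdd] A_refl[OF zR] by blast
    moreover have "d w \<le> Sup (d ` A z)" if "w \<in> A z" for w
      using that bdd by (intro cSup_upper) auto
    ultimately show ?thesis by (intro bexI[of _ z']) force+
  qed
  \<comment> \<open>Greedy choice: the next point lies in \<open>A (f n)\<close> and comes within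
    \<open>(1/2) ^ n\<close> of the supremum of \<open>d\<close> there.\<close>
  have "\<exists>f. \<forall>n. f n \<in> A x \<and> (f (Suc n) \<in> A (f n) \<and> (\<forall>w\<in>A (f n). d w \<le> d (f (Suc n)) + (1/2) ^ n))"
  proof (rule dependent_nat_choice)
    show "\<exists>z. z \<in> A x" using A_refl[of x] R by (auto simp: N_zero)
  next
    fix z and n :: nat assume z: "z \<in> A x"
    then have "N (z - x) \<le> R" by (simp add: A_def)
    with step[OF this, of n] A_trans[OF z]
    show "\<exists>z'. z' \<in> A x \<and> (z' \<in> A z \<and> (\<forall>w\<in>A z. d w \<le> d z' + (1/2) ^ n))" by blast
  qed
  then obtain f where f: "\<And>n. f n \<in> A x" "\<And>n. f (Suc n) \<in> A (f n)"
    "\<And>n w. w \<in> A (f n) \<Longrightarrow> d w \<le> d (f (Suc n)) + (1/2) ^ n" by metis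
  have A_mono: "A (f m) \<subseteq> A (f n)" if "n \<le> m" for m n
    using lift_Suc_antimono_le[of "\<lambda>n. A (f n)", OF A_trans[OF f(2)] that] .
  have f_mem: "f m \<in> A (f n)" if "n \<le> m" for m n
    using A_mono[OF that] A_refl[of "f m"] f(1)[of m] by (auto simp: A_def)
  \<comment> \<open>Membership in \<open>A (f (Suc n))\<close> makes \<open>d\<close> grow by at
    least \<open>\<sigma> * N (w - f (Suc n))\<close>, whereas the greedy choice leaves at most
    \<open>(1/2) ^ n\<close> to gain. The sets therefore shrink to a single point.\<close>
  have close: "norm (w - f (Suc n)) \<le> (1/2) ^ n / (\<sigma> * c)" if "w \<in> A (f (Suc n))" for w n
  proof -
    have "w \<in> A (f n)" using that A_mono[of n "Suc n"] by auto
    then have "\<sigma> * N (w - f (Suc n)) \<le> (1/2) ^ n"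
      using f(3)[of w n] that by (simp add: A_def)
    moreover have "\<sigma> * (c * norm (w - f (Suc n))) \<le> \<sigma> * N (w - f (Suc n))"
      using lower \<sigma> by (intro mult_left_mono) auto
    ultimately have "norm (w - f (Suc n)) * (\<sigma> * c) \<le> (1/2) ^ n" by (simp add: mult_ac)
    then show ?thesis using \<sigma> c_pos by (simp add: pos_le_divide_eq)
  qed
  have lim0: "(\<lambda>n. (1/2) ^ n / (\<sigma> * c)) \<longlonglongrightarrow> 0"
    using tendsto_divide[OF LIMSEQ_power_zero[of "1/2 :: real"] tendsto_const[of "\<sigma> * c"]] \<sigma> c_pos
    by simp
  have "Cauchy f"
  proof (rule CauchyI)
    fix e :: real assume "0 < e"
    then have "\<forall>\<^sub>F n in sequentially. (1/2) ^ n / (\<sigma> * c) < e / 2"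
      using lim0 by (intro order_tendstoD(2)) auto
    then obtain n where n: "(1/2) ^ n / (\<sigma> * c) < e / 2"
      unfolding eventually_sequentially by blast
    have "norm (f k - f m) < e" if "k \<ge> Suc n" "m \<ge> Suc n" for k m
    proof -
      have "norm (f k - f m) \<le> norm (f k - f (Suc n)) + norm (f m - f (Suc n))"
        using norm_triangle_ineq4[of "f k - f (Suc n)" "f m - f (Suc n)"] by simp
      then show ?thesis
        using close[OF f_mem[OF that(1)]] close[OF f_mem[OF that(2)]] n by linarith
    qed
    then show "\<exists>n. \<forall>k\<ge>n. \<forall>m\<ge>n. norm (f k - f m) < e" by blast
  qed
  then obtain z where z: "f \<longlonglongrightarrow> z" using Cauchy_convergent_iff convergent_def by blast
  have zA: "z \<in> A (f n)" for n
    using f_mem[of n] by (intro A_closed[OF _ z] eventually_sequentiallyI[of n]) 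
  have zx: "z \<in> A x" using zA A_trans[OF f(1)] by blast
  have maximal: "w = z" if w: "w \<in> A z" for w
  proof -
    have "norm (f (Suc n) - w) \<le> (1/2) ^ n / (\<sigma> * c)" for n
      using close A_trans[OF zA] w by (metis norm_minus_commute subsetD)
    then have "(\<lambda>n. f (Suc n) - w) \<longlonglongrightarrow> 0"
      by (intro Lim_null_comparison[OF _ lim0] always_eventually) auto
    then have "(\<lambda>n. f (Suc n)) \<longlonglongrightarrow> w" by (rule LIM_zero_cancel)
    then show "w = z" using z LIMSEQ_Suc LIMSEQ_unique by blast
  qed
  have zR: "N (z - x) \<le> R" and dz: "d x + \<sigma> * N (z - x) \<le> d z"
    using zx by (simp_all add: A_def)
  have "N (z - x) = R"
  proof (rule ccontr)
    assume "N (z - x) \<noteq> R"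
    then have "0 < R - N (z - x)" using zR by simp
    moreover have "0 < d z"
      using dz x N_nonneg[of "z - x"] \<sigma> by (smt (verit) mult_nonneg_nonneg)
    ultimately obtain w where w: "w \<noteq> z" "N (w - z) \<le> R - N (z - x)" "d z + \<sigma> * N (w - z) \<le> d w"
      using distance_ascent \<sigma>(2) by metis
    have "w \<in> A z" using w triangle_diff[of w x z] by (simp add: A_def)
    then show False using maximal w(1) by blast
  qed
  then show thesis using dz by (intro that[of z]) auto
qed

text \<open>Smoothness turns the balls of centre \<open>z\<close> and radius \<open>d z\<close>, which avoid \<open>K\<close>, into almost half
  spaces as \<open>N (z - x)\<close> grows, so that \<open>x\<close> cannot lie between two points of \<open>K\<close>.\<close>

theorem convex_K: "convex K"
proof (rule convexI, rule ccontr)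
  fix a b :: 'a and u v :: real
  assume ab: "a \<in> K" "b \<in> K" and uv: "0 \<le> u" "0 \<le> v" "u + v = 1"
  define x where "x = u *\<^sub>R a + v *\<^sub>R b"
  assume "u *\<^sub>R a + v *\<^sub>R b \<notin> K"
  then have "d x \<noteq> 0" using d_zero by (auto simp: x_def)
  define \<rho> where "\<rho> = d x"
  have \<rho>: "0 < \<rho>" using \<open>d x \<noteq> 0\<close> N_nonneg[of "x - P x"] by (simp add: \<rho>_def d_def)
  define e where "e = b - a"
  have "a = (u + v) *\<^sub>R a" "b = (u + v) *\<^sub>R b" using uv by simp_all
  then have xa: "x - a = v *\<^sub>R e" and xb: "x - b = - (u *\<^sub>R e)"
    by (simp_all add: x_def e_def algebra_simps)
  \<comment> \<open>With this choice smoothness bounds the sum of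
    \<open>N (w + h *\<^sub>R e)\<close> and \<open>N (w - h *\<^sub>R e)\<close> by
    \<open>2 + h * \<rho>\<close>, whereas \<open>side\<close> makes it at least
    \<open>2 + 2 * (h * (\<rho> - h))\<close>. These are incompatible once
    \<open>h < \<rho> / 2\<close>.\<close>
  define \<epsilon> where "\<epsilon> = \<rho> / (N e + 1)"
  have Ne: "0 < N e + 1" using N_nonneg[of e] by simp
  have \<epsilon>: "0 < \<epsilon>" using \<rho> Ne by (simp add: \<epsilon>_def)
  obtain \<delta> where \<delta>: "0 < \<delta>" and sm: "\<And>w h. \<lbrakk>N w = 1; N h \<le> \<delta>\<rbrakk> \<Longrightarrow> N (w + h) + N (w - h) \<le> 2 + \<epsilon> * N h"
    using smooth[OF \<epsilon>] by blast
  \<comment> \<open>The entries keep the rate \<open>1 - h * h\<close> positive, give the final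
    contradiction, and make \<open>h *\<^sub>R e\<close> an admissible perturbation for
    \<open>sm\<close>.\<close>
  define h0 where "h0 = min 1 (min (\<rho> / 2) (\<delta> / (N e + 1)))"
  have "0 < h0" using \<rho> \<delta> Ne by (simp add: h0_def)
  then obtain n where n: "inverse (real (Suc n)) < h0" using reals_Archimedean by blast
  define h where "h = inverse (real (Suc n))"
  have h: "0 < h" "h < 1" "h < \<rho> / 2" "h < \<delta> / (N e + 1)"
    using n by (auto simp: h_def h0_def)
  have hN: "h * N e \<le> \<delta>"
  proof -
    have "h * N e \<le> h * (N e + 1)" using h by (intro mult_left_mono) auto
    also have "\<dots> \<le> \<delta>" using h(4) Ne by (simp add: pos_less_divide_eq)
    finally show ?thesis .
  qed
  \<comment> \<open>Rate \<open>1 - h * h\<close> and radius \<open>1 / h\<close> are matched: the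
    distance gained falls short of the radius by only \<open>h\<close>, and rescaling by
    \<open>h\<close> turns this into \<open>1 + h * (\<rho> - h) \<le> h * d z\<close>.\<close>
  have h2: "0 < 1 - h * h" "1 - h * h < 1"
    using h mult_strict_mono[of h 1 h 1] by auto
  obtain z where z: "N (z - x) = 1 / h" "d x + (1 - h * h) * (1 / h) \<le> d z"
    using far_distance_ascent[OF _ h2, of x "1 / h"] \<rho> h(1) unfolding \<rho>_def by auto
  define w where "w = h *\<^sub>R (z - x)"
  have Nw: "N w = 1" using z(1) h by (simp add: w_def scale)
  have dz: "1 + h * (\<rho> - h) \<le> h * d z"
  proof -
    have "h * (\<rho> + (1 - h * h) * (1 / h)) \<le> h * d z"
      using z(2) h unfolding \<rho>_def by (intro mult_left_mono) auto
    then show ?thesis using h by (simp add: algebra_simps)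
  qed
  have hp: "0 < h * (\<rho> - h)" using h by simp
  \<comment> \<open>The vector \<open>h *\<^sub>R (z - k)\<close> lies on the segment from
    \<open>w\<close> to \<open>w + e'\<close>. As \<open>N w = 1\<close> and \<open>N\<close> is
    convex, an excess over 1 inside the segment is also present at its far end. The same step
    \<open>e'\<close>, up to sign, thus serves both endpoints \<open>a\<close> and
    \<open>b\<close>.\<close>
  have side: "1 + h * (\<rho> - h) \<le> N (w + e')"
    if k: "k \<in> K" and xk: "h *\<^sub>R (x - k) = s *\<^sub>R e'" and s: "0 \<le> s" "s \<le> 1" for k s e'
  proof -
    have "h * d z \<le> h * N (z - k)" using d_le[OF k] h by (intro mult_left_mono) auto
    also have "\<dots> = N (h *\<^sub>R (z - k))" using h by (simp add: scale)
    also have "h *\<^sub>R (z - k) = w + h *\<^sub>R (x - k)" by (simp add: w_def algebra_simps)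
    also have "\<dots> = s *\<^sub>R (w + e') + (1 - s) *\<^sub>R w" unfolding xk by (simp add: algebra_simps)
    also have "N \<dots> \<le> s * N (w + e') + (1 - s)"
      using triangle[of "s *\<^sub>R (w + e')" "(1 - s) *\<^sub>R w"] s by (simp add: scale Nw)
    finally have *: "h * (\<rho> - h) \<le> s * (N (w + e') - 1)"
      using dz by (simp add: right_diff_distrib)
    then have "0 < s * (N (w + e') - 1)" using hp by linarith
    then have "0 < N (w + e') - 1" using s by (simp add: zero_less_mult_iff)
    then have "s * (N (w + e') - 1) \<le> N (w + e') - 1"
      using s mult_right_mono[of s 1 "N (w + e') - 1"] by simp
    then show ?thesis using * by linarith
  qed
  have "1 + h * (\<rho> - h) \<le> N (w + h *\<^sub>R e)"
    using ab(1) uv by (intro side[of a v]) (auto simp: xa)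
  moreover have "1 + h * (\<rho> - h) \<le> N (w + - (h *\<^sub>R e))"
    using ab(2) uv by (intro side[of b u]) (auto simp: xb)
  moreover have "N (w + h *\<^sub>R e) + N (w - h *\<^sub>R e) \<le> 2 + \<epsilon> * N (h *\<^sub>R e)"
    using hN h by (intro sm Nw) (simp add: scale)
  moreover have "\<epsilon> * N (h *\<^sub>R e) \<le> h * \<rho>"
  proof -
    have "\<epsilon> * N (h *\<^sub>R e) = h * (\<epsilon> * N e)" using h by (simp add: scale)
    also have "\<epsilon> * N e \<le> \<epsilon> * (N e + 1)" using \<epsilon> by (intro mult_left_mono) auto
    then have "h * (\<epsilon> * N e) \<le> h * \<rho>" using Ne h by (intro mult_left_mono) (auto simp: \<epsilon>_def)
    finally show ?thesis .
  qed
  ultimately have "2 * (h * (\<rho> - h)) \<le> h * \<rho>" by simp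
  then have "h * (2 * (\<rho> - h)) \<le> h * \<rho>" by (simp add: algebra_simps)
  then have "2 * (\<rho> - h) \<le> \<rho>" using h by simp
  then show False using h(3) by (simp add: right_diff_distrib)
qed

end

section \<open>The \<open>p\<close>-sum norm\<close>

lemma powr_above_tangent:
  fixes a b p :: real
  assumes p: "1 \<le> p" and ab: "0 \<le> a" "0 \<le> b"
  shows "a powr p + p * a powr (p - 1) * (b - a) \<le> b powr p"
proof -
  consider "a = 0" | "0 < a" "b = 0" | "0 < a" "0 < b" using ab by linarith
  then show ?thesis
  proof cases
    case 2
    then have "a powr (p - 1) * a = a powr p" by (simp add: powr_mult_base mult.commute)
    then have "p * a powr (p - 1) * (b - a) = - (p * a powr p)"
      using 2 by (simp add: mult.assoc)
    moreover have "1 * a powr p \<le> p * a powr p" using p by (intro mult_right_mono) auto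
    moreover have "b powr p = 0" using 2 by simp
    ultimately show ?thesis by linarith
  next
    case 3
    have "((\<lambda>x. x powr p) has_field_derivative p * a powr (p - 1)) (at a within {0<..})"
      by (rule has_field_derivative_at_within[OF has_real_derivative_powr[OF 3(1)]])
    then have "b powr p - a powr p \<ge> p * a powr (p - 1) * (b - a)"
      using 3 by (intro convex_on_imp_above_tangent[OF powr_convex[OF p]]) (auto simp: interior_open)
    then show ?thesis by simp
  qed (use p in auto)
qed

text \<open>Averaging the tangent inequalities at the combined point cancels the slope
  terms.\<close>

lemma powr_convex_nonneg:
  fixes a b p :: real
  assumes p: "1 \<le> p" and ab: "0 \<le> a" "0 \<le> b" and st: "0 \<le> s" "0 \<le> t" "s + t = 1"
  shows "(s * a + t * b) powr p \<le> s * a powr p + t * b powr p"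
proof -
  define c where "c = s * a + t * b"
  define k where "k = p * c powr (p - 1)"
  have c: "0 \<le> c" using ab st by (simp add: c_def)
  have "s * (c powr p + k * (a - c)) \<le> s * a powr p" "t * (c powr p + k * (b - c)) \<le> t * b powr p"
    using powr_above_tangent[OF p c ab(1)] powr_above_tangent[OF p c ab(2)] st
    by (auto intro!: mult_left_mono simp: k_def)
  moreover have "s * (c powr p + k * (a - c)) + t * (c powr p + k * (b - c))
      = (s + t) * c powr p + k * (c - (s + t) * c)"
    by (simp add: c_def algebra_simps)
  ultimately show ?thesis using st(3) by (simp add: c_def)
qed

text \<open>A component of a unit vector of the product may be small or zero, where the norm itself
  is not smooth. The power with \<open>1 < p\<close> is flat there, which gives an estimate uniform
  on the whole unit ball.\<close>

lemma norm_powr_smooth: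
  assumes us: "uniformly_smooth TYPE('a::real_normed_vector)" and p: "1 < p" and e: "0 < \<epsilon>"
  obtains \<delta> where "0 < \<delta>"
    "\<And>x h :: 'a. \<lbrakk>norm x \<le> 1; norm h \<le> \<delta>\<rbrakk>
      \<Longrightarrow> norm (x + h) powr p + norm (x - h) powr p \<le> 2 * norm x powr p + \<epsilon> * norm h"
proof -
  define \<epsilon>' where "\<epsilon>' = \<epsilon> / (4 * p)"
  have e': "0 < \<epsilon>'" using e p by (simp add: \<epsilon>'_def)
  obtain \<delta>1 where d1: "0 < \<delta>1" and sm: "\<And>x h :: 'a. norm h \<le> \<delta>1 * norm x \<Longrightarrow>
      norm (x + h) + norm (x - h) \<le> 2 * norm x + 2 * \<epsilon>' * norm h"
    using uniformly_smoothD[OF us e'] by metis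
  have "continuous_on {0..2} (\<lambda>t::real. t powr (p - 1))"
    using p by (intro continuous_on_powr' continuous_intros) auto
  then have "uniformly_continuous_on {0..2} (\<lambda>t::real. t powr (p - 1))"
    by (intro compact_uniformly_continuous) auto
  then obtain \<delta>2 where d2: "0 < \<delta>2" and
    ucont: "\<And>s t :: real. \<lbrakk>0 \<le> s; s \<le> 2; 0 \<le> t; t \<le> 2; \<bar>s - t\<bar> < \<delta>2\<rbrakk>
      \<Longrightarrow> \<bar>s powr (p - 1) - t powr (p - 1)\<bar> < \<epsilon>'"
    using e' unfolding uniformly_continuous_on_def dist_real_def by (metis atLeastAtMost_iff)
  \<comment> \<open>The bound 1 keeps \<open>A\<close> and \<open>B\<close> in
    \<open>{0..2}\<close>, \<open>\<delta>2\<close> makes the slopes at \<open>A\<close>,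
    \<open>B\<close> and \<open>a\<close> nearly equal, and \<open>\<delta>1 * \<delta>2\<close>
    forces \<open>a < \<delta>2\<close> whenever \<open>h\<close> is too large relative to
    \<open>x\<close> for \<open>sm\<close>.\<close>
  define \<delta> where "\<delta> = min 1 (min (\<delta>2 / 2) (\<delta>1 * \<delta>2 / 2))"
  have d: "0 < \<delta>" "\<delta> \<le> 1" "\<delta> < \<delta>2" "\<delta> < \<delta>1 * \<delta>2"
    using d1 d2 by (auto simp: \<delta>_def min_less_iff_disj)
  show thesis
  proof (rule that[OF d(1)])
    fix x h :: 'a
    assume x: "norm x \<le> 1" and h: "norm h \<le> \<delta>"
    define a A B where "a = norm x" and "A = norm (x + h)" and "B = norm (x - h)"
    have pos: "0 \<le> a" "0 \<le> A" "0 \<le> B" by (simp_all add: a_def A_def B_def)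
    have Aa: "\<bar>A - a\<bar> \<le> norm h" unfolding A_def a_def using norm_triangle_ineq3[of "x + h" x] by simp
    have Ba: "\<bar>B - a\<bar> \<le> norm h" unfolding B_def a_def using norm_triangle_ineq3[of "x - h" x] by simp
    have second: "(t powr (p - 1) - a powr (p - 1)) * (t - a) \<le> \<epsilon>' * norm h"
      if "0 \<le> t" "\<bar>t - a\<bar> \<le> norm h" for t
    proof -
      have "\<bar>t powr (p - 1) - a powr (p - 1)\<bar> < \<epsilon>'"
        using that x h d pos by (intro ucont) (auto simp: a_def)
      then have "\<bar>t powr (p - 1) - a powr (p - 1)\<bar> * \<bar>t - a\<bar> \<le> \<epsilon>' * norm h"
        using that by (intro mult_mono) auto
      then show ?thesis by (simp flip: abs_mult)
    qed
    have first: "a powr (p - 1) * (A + B - 2 * a) \<le> 2 * \<epsilon>' * norm h"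
    proof (cases "norm h \<le> \<delta>1 * a")
      case True
      have "a powr (p - 1) \<le> 1" using p x pos by (simp add: powr_le1 a_def)
      moreover have "A + B - 2 * a \<le> 2 * \<epsilon>' * norm h"
        using sm[of h x] True by (simp add: A_def B_def a_def)
      ultimately have "a powr (p - 1) * (A + B - 2 * a) \<le> a powr (p - 1) * (2 * \<epsilon>' * norm h)"
        by (intro mult_left_mono) auto
      also have "\<dots> \<le> 1 * (2 * \<epsilon>' * norm h)"
        using \<open>a powr (p - 1) \<le> 1\<close> e' by (intro mult_right_mono) auto
      finally show ?thesis by simp
    next
      case False
      \<comment> \<open>Here \<open>x\<close> is so short that the slope
        \<open>a powr (p - 1)\<close> is at most \<open>\<epsilon>'\<close>, which compensates for
        the crude bound \<open>2 * norm h\<close> on the second difference.\<close>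
      then have "\<delta>1 * a < \<delta>1 * \<delta>2" using h d by linarith
      then have "\<bar>a - 0\<bar> < \<delta>2" using d1 pos by simp
      then have "\<bar>a powr (p - 1) - 0 powr (p - 1)\<bar> < \<epsilon>'"
        using x pos by (intro ucont) (auto simp: a_def)
      then have "a powr (p - 1) \<le> \<epsilon>'" by simp
      moreover have "A + B - 2 * a \<le> 2 * norm h" using Aa Ba by linarith
      ultimately have "a powr (p - 1) * (A + B - 2 * a) \<le> a powr (p - 1) * (2 * norm h)"
        by (intro mult_left_mono) auto
      also have "\<dots> \<le> \<epsilon>' * (2 * norm h)"
        using \<open>a powr (p - 1) \<le> \<epsilon>'\<close> by (intro mult_right_mono) auto
      finally show ?thesis by simp
    qed
    \<comment> \<open>The tangents are taken at \<open>A\<close> and \<open>B\<close> to bound the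
      increments from above; \<open>second\<close> then pays for moving both slopes to
      \<open>a\<close>.\<close>
    have "A powr p - a powr p \<le> p * (A powr (p - 1) * (A - a))"
      using powr_above_tangent[of p A a] p pos by (simp add: algebra_simps)
    moreover have "B powr p - a powr p \<le> p * (B powr (p - 1) * (B - a))"
      using powr_above_tangent[of p B a] p pos by (simp add: algebra_simps)
    ultimately have "A powr p + B powr p - 2 * a powr p
        \<le> p * (A powr (p - 1) * (A - a) + B powr (p - 1) * (B - a))"
      by (simp add: distrib_left)
    also have "A powr (p - 1) * (A - a) + B powr (p - 1) * (B - a)
        = a powr (p - 1) * (A + B - 2 * a)
          + ((A powr (p - 1) - a powr (p - 1)) * (A - a) + (B powr (p - 1) - a powr (p - 1)) * (B - a))"
      by (simp add: algebra_simps)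
    also have "p * \<dots> \<le> p * (2 * \<epsilon>' * norm h + (\<epsilon>' * norm h + \<epsilon>' * norm h))"
      using first second[OF pos(2) Aa] second[OF pos(3) Ba] p by (intro mult_left_mono add_mono) auto
    also have "\<dots> = \<epsilon> * norm h" using p by (simp add: \<epsilon>'_def field_simps)
    finally show "norm (x + h) powr p + norm (x - h) powr p \<le> 2 * norm x powr p + \<epsilon> * norm h"
      by (simp add: A_def B_def a_def)
  qed
qed

section \<open>The objective and its \<open>p\<close>-th root as a smooth norm\<close>

definition cost :: "real \<Rightarrow> 'y::real_normed_vector \<times> 'u::real_normed_vector \<Rightarrow> real" where
  "cost p z = norm (fst z) powr p + norm (snd z) powr p"

definition pnorm :: "real \<Rightarrow> 'y::real_normed_vector \<times> 'u::real_normed_vector \<Rightarrow> real" where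
  "pnorm p z = cost p z powr (1 / p)"

lemma cost_nonneg: "0 \<le> cost p z"
  by (simp add: cost_def)

lemma pnorm_nonneg: "0 \<le> pnorm p z"
  by (simp add: pnorm_def)

lemma pnorm_powr: "0 < p \<Longrightarrow> pnorm p z powr p = cost p z"
  by (simp add: pnorm_def powr_powr cost_nonneg)

lemma cost_scaleR: "cost p (r *\<^sub>R z) = \<bar>r\<bar> powr p * cost p z"
  by (simp add: cost_def powr_mult distrib_left)

lemma pnorm_scaleR: "0 < p \<Longrightarrow> pnorm p (r *\<^sub>R z) = \<bar>r\<bar> * pnorm p z"
  by (simp add: pnorm_def cost_scaleR powr_mult cost_nonneg powr_powr)

lemma norm_fst_le_pnorm: "0 < p \<Longrightarrow> norm (fst z) \<le> pnorm p z"
  using powr_mono2[of "1 / p" "norm (fst z) powr p" "cost p z"]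
  by (simp add: pnorm_def cost_def powr_powr)

lemma norm_snd_le_pnorm: "0 < p \<Longrightarrow> norm (snd z) \<le> pnorm p z"
  using powr_mono2[of "1 / p" "norm (snd z) powr p" "cost p z"]
  by (simp add: pnorm_def cost_def powr_powr)

lemma norm_le_pnorm: "0 < p \<Longrightarrow> norm z \<le> 2 * pnorm p z"
  using norm_fst_le_pnorm[of p z] norm_snd_le_pnorm[of p z] norm_Pair_le[of "fst z" "snd z"] by simp

lemma pnorm_mono: "0 < p \<Longrightarrow> cost p z \<le> cost p w \<Longrightarrow> pnorm p z \<le> pnorm p w"
  unfolding pnorm_def by (intro powr_mono2) (auto simp: cost_nonneg)

lemma cost_convex:
  assumes "1 \<le> p" "0 \<le> s" "0 \<le> t" "s + t = 1"
  shows "cost p (s *\<^sub>R x + t *\<^sub>R y) \<le> s * cost p x + t * cost p y"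
proof -
  have "norm (s *\<^sub>R v + t *\<^sub>R w) powr p \<le> s * norm v powr p + t * norm w powr p"
    for v w :: "'x::real_normed_vector"
  proof -
    have "norm (s *\<^sub>R v + t *\<^sub>R w) \<le> s * norm v + t * norm w"
      using norm_triangle_ineq[of "s *\<^sub>R v" "t *\<^sub>R w"] assms by simp
    then have "norm (s *\<^sub>R v + t *\<^sub>R w) powr p \<le> (s * norm v + t * norm w) powr p"
      using assms by (intro powr_mono2) auto
    also have "\<dots> \<le> s * norm v powr p + t * norm w powr p"
      using assms by (intro powr_convex_nonneg) auto
    finally show ?thesis .
  qed
  from this[of "fst x" "fst y"] this[of "snd x" "snd y"] show ?thesis
    by (simp add: cost_def distrib_left)
qed

text \<open>Minkowski's inequality from convexity of the unit ball: \<open>x + y\<close> is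
  \<open>a + b\<close> times a convex combination of the normalised vectors, and \<open>cost\<close>
  is convex.\<close>

lemma pnorm_triangle:
  assumes p: "1 \<le> p"
  shows "pnorm p (x + y) \<le> pnorm p x + pnorm p y"
proof (cases "pnorm p x = 0 \<or> pnorm p y = 0")
  case True
  then have "x = 0 \<or> y = 0" using norm_le_pnorm[of p x] norm_le_pnorm[of p y] p by auto
  then show ?thesis using pnorm_nonneg by fastforce
next
  case False
  define a b where "a = pnorm p x" and "b = pnorm p y"
  have ab: "0 < a" "0 < b"
    using False pnorm_nonneg[of p x] pnorm_nonneg[of p y] by (auto simp: a_def b_def)
  define x' y' where "x' = x /\<^sub>R a" and "y' = y /\<^sub>R b"
  have "pnorm p x' = 1" "pnorm p y' = 1"
    using ab p by (simp_all add: x'_def y'_def pnorm_scaleR) (simp_all add: a_def b_def)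
  then have unit: "cost p x' = 1" "cost p y' = 1"
    using pnorm_powr[of p x'] pnorm_powr[of p y'] p by auto
  define s t where "s = a / (a + b)" and "t = b / (a + b)"
  have st: "0 \<le> s" "0 \<le> t" "s + t = 1"
    using ab by (simp_all add: s_def t_def flip: add_divide_distrib)
  have "cost p (s *\<^sub>R x' + t *\<^sub>R y') \<le> 1"
    using cost_convex[OF p st, of x' y'] st by (simp add: unit)
  then have 1: "pnorm p (s *\<^sub>R x' + t *\<^sub>R y') \<le> 1"
    using p by (simp add: pnorm_def powr_le1 cost_nonneg)
  have "x + y = (a + b) *\<^sub>R (s *\<^sub>R x' + t *\<^sub>R y')"
    using ab by (simp add: scaleR_add_right s_def t_def x'_def y'_def)
  then have "pnorm p (x + y) = (a + b) * pnorm p (s *\<^sub>R x' + t *\<^sub>R y')"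
    using ab p by (simp add: pnorm_scaleR)
  also have "\<dots> \<le> (a + b) * 1" using 1 ab by (intro mult_left_mono) auto
  finally show ?thesis by (simp add: a_def b_def)
qed

lemma pnorm_le_norm:
  fixes z :: "'y::real_normed_vector \<times> 'u::real_normed_vector"
  assumes p: "1 \<le> p"
  shows "pnorm p z \<le> 2 * norm z"
proof -
  have "pnorm p (fst z, 0 :: 'u) = norm (fst z)" "pnorm p (0 :: 'y, snd z) = norm (snd z)"
    using p by (simp_all add: pnorm_def cost_def powr_powr)
  moreover have "pnorm p z \<le> pnorm p (fst z, 0 :: 'u) + pnorm p (0 :: 'y, snd z)"
    using pnorm_triangle[OF p, of "(fst z, 0 :: 'u)" "(0 :: 'y, snd z)"] by simp
  ultimately show ?thesis 
    using norm_fst_le[of "fst z" "snd z"] norm_snd_le[of "snd z" "fst z"] by simp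
qed

text \<open>Adding the estimates for the two components gives smoothness of \<open>cost\<close>. The
  tangent of the power at 1 gives \<open>p * (pnorm p w - 1) \<le> cost p w - 1\<close>, which
  transfers it to \<open>pnorm\<close>. The halves of \<open>\<epsilon>\<close> account for two
  component norms, each bounded by \<open>pnorm p y\<close>.\<close>

lemma pnorm_smooth:
  assumes "uniformly_smooth TYPE('y::real_normed_vector)" "uniformly_smooth TYPE('u::real_normed_vector)"
    and p: "1 < p" and e: "0 < \<epsilon>"
  shows "\<exists>\<delta>>0. \<forall>x y :: 'y \<times> 'u. pnorm p x = 1 \<longrightarrow> pnorm p y \<le> \<delta>
    \<longrightarrow> pnorm p (x + y) + pnorm p (x - y) \<le> 2 + \<epsilon> * pnorm p y"
proof -
  obtain \<delta>1 where d1: "0 < \<delta>1" "\<And>x h :: 'y. \<lbrakk>norm x \<le> 1; norm h \<le> \<delta>1\<rbrakk>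
      \<Longrightarrow> norm (x + h) powr p + norm (x - h) powr p \<le> 2 * norm x powr p + \<epsilon> / 2 * norm h"
    using norm_powr_smooth[OF assms(1) p, of "\<epsilon> / 2"] e by (metis half_gt_zero)
  obtain \<delta>2 where d2: "0 < \<delta>2" "\<And>x h :: 'u. \<lbrakk>norm x \<le> 1; norm h \<le> \<delta>2\<rbrakk>
      \<Longrightarrow> norm (x + h) powr p + norm (x - h) powr p \<le> 2 * norm x powr p + \<epsilon> / 2 * norm h"
    using norm_powr_smooth[OF assms(2) p, of "\<epsilon> / 2"] e by (metis half_gt_zero)
  show ?thesis
  proof (intro exI[of _ "min \<delta>1 \<delta>2"] conjI allI impI)
    fix x y :: "'y \<times> 'u"
    assume x: "pnorm p x = 1" and y: "pnorm p y \<le> min \<delta>1 \<delta>2"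
    have p0: "0 < p" using p by simp
    note le = norm_fst_le_pnorm[OF p0] norm_snd_le_pnorm[OF p0]
    have "cost p (x + y) + cost p (x - y) \<le> 2 * cost p x + \<epsilon> / 2 * (norm (fst y) + norm (snd y))"
      using d1(2)[of "fst x" "fst y"] d2(2)[of "snd x" "snd y"] le[of x] le[of y] x y
      by (simp add: cost_def algebra_simps)
    also have "cost p x = 1" using pnorm_powr[OF p0, of x] x by simp
    also have "\<epsilon> / 2 * (norm (fst y) + norm (snd y)) \<le> \<epsilon> / 2 * (2 * pnorm p y)"
      using le[of y] e by (intro mult_left_mono) auto
    finally have sum: "cost p (x + y) + cost p (x - y) \<le> 2 + \<epsilon> * pnorm p y" by simp
    have "p * (pnorm p w - 1) \<le> cost p w - 1" for w :: "'y \<times> 'u"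
      using powr_above_tangent[of p 1 "pnorm p w"] pnorm_powr[OF p0, of w] p pnorm_nonneg[of p w] by simp
    from this[of "x + y"] this[of "x - y"] sum
    have *: "p * (pnorm p (x + y) + pnorm p (x - y) - 2) \<le> \<epsilon> * pnorm p y"
      by (simp add: algebra_simps)
    define D where "D = pnorm p (x + y) + pnorm p (x - y) - 2"
    have "D \<le> \<epsilon> * pnorm p y"
    proof (cases "0 \<le> D")
      case True
      then have "1 * D \<le> p * D" using p by (intro mult_right_mono) auto
      then show ?thesis using * unfolding D_def[symmetric] by linarith
    next
      case False
      moreover have "0 \<le> \<epsilon> * pnorm p y" using e pnorm_nonneg[of p y] by simp
      ultimately show ?thesis by linarith
    qed
    then show "pnorm p (x + y) + pnorm p (x - y) \<le> 2 + \<epsilon> * pnorm p y"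
      by (simp add: D_def)
  qed (use d1 d2 in auto)
qed

section \<open>Projection onto the graph\<close>

lemma tendsto_converges_weakly: "X \<longlonglongrightarrow> x \<Longrightarrow> converges_weakly X x"
  unfolding converges_weakly_def by (blast intro: bounded_linear.tendsto)

lemma converges_weakly_diff:
  assumes "converges_weakly X x" "converges_weakly Y y"
  shows "converges_weakly (\<lambda>n. X n - Y n) (x - y)"
  using assms unfolding converges_weakly_def
  by (auto simp: bounded_linear.linear linear_diff intro: tendsto_diff)

lemma norm_powr_weak_lower_semicontinuous:
  fixes y :: "'a::real_normed_vector"
  assumes us: "uniformly_smooth TYPE('a)" and w: "converges_weakly Y y"
    and p: "0 < p" and c: "c < norm y powr p"
  shows "\<forall>\<^sub>F n in sequentially. c < norm (Y n) powr p"
proof (cases "c < 0")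
  case True
  then show ?thesis by (intro always_eventually) (auto intro: order_less_le_trans)
next
  case False
  have root: "(s powr p) powr (1 / p) = s" "(s powr (1 / p)) powr p = s" if "0 \<le> s" for s :: real
    unfolding powr_powr using p that by simp_all
  have "c powr (1 / p) < norm y"
    using powr_less_mono2[of "1 / p" c "norm y powr p"] p c False by (simp add: root)
  then have "\<forall>\<^sub>F n in sequentially. c powr (1 / p) < norm (Y n)"
    by (rule norm_weak_lower_semicontinuous[OF us w])
  then show ?thesis
  proof eventually_elim
    case (elim n)
    then show ?case using powr_less_mono2[of p "c powr (1 / p)" "norm (Y n)"] p False by (simp add: root)
  qed
qed

text \<open>The other summand eventually uses up nearly all of \<open>B\<close>, and since
  \<open>D \<le> A + B\<close> nothing is left for \<open>f\<close> to exceed \<open>A\<close>. This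
  splits convergence of the objective into convergence of each component norm.\<close>

lemma tendsto_summand:
  fixes f g :: "nat \<Rightarrow> real"
  assumes lim: "(\<lambda>n. f n + g n) \<longlonglongrightarrow> D" and le: "D \<le> A + B"
    and f: "\<And>c. c < A \<Longrightarrow> \<forall>\<^sub>F n in sequentially. c < f n"
    and g: "\<And>c. c < B \<Longrightarrow> \<forall>\<^sub>F n in sequentially. c < g n"
  shows "f \<longlonglongrightarrow> A"
proof (rule order_tendstoI)
  fix c assume c: "A < c"
  define e where "e = (c - A) / 2"
  have e: "0 < e" using c by (simp add: e_def)
  have "\<forall>\<^sub>F n in sequentially. f n + g n < D + e"
    using lim e by (intro order_tendstoD(2)) auto
  moreover have "\<forall>\<^sub>F n in sequentially. B - e < g n" using e by (intro g) simp
  ultimately show "\<forall>\<^sub>F n in sequentially. f n < c"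
  proof eventually_elim
    case (elim n)
    moreover have "c = A + e + e" by (simp add: e_def)
    ultimately show ?case using le by linarith
  qed
qed (rule f)

lemma norm_tendsto_of_powr:
  assumes "0 < p" "(\<lambda>n. norm (Y n) powr p) \<longlonglongrightarrow> norm y powr p"
  shows "(\<lambda>n. norm (Y n)) \<longlonglongrightarrow> norm y"
proof -
  have "(\<lambda>n. (norm (Y n) powr p) powr (1 / p)) \<longlonglongrightarrow> (norm y powr p) powr (1 / p)"
    by (rule tendsto_powr'[OF assms(2) tendsto_const]) (use assms(1) in auto)
  then show ?thesis using assms(1) by (simp add: powr_powr)
qed

text \<open>Letting the data \<open>X n\<close> vary covers two uses: a constant \<open>X\<close>
  gives existence of a nearest point, and \<open>X\<close> tending to \<open>x\<close> gives
  continuity of the projection.\<close>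

lemma graph_minimizing_sequence:
  fixes S :: "'u::banach \<Rightarrow> 'y::banach"
  assumes uc: "uniformly_convex TYPE('y)" "uniformly_convex TYPE('u)"
    and us: "uniformly_smooth TYPE('y)" "uniformly_smooth TYPE('u)"
    and p: "1 < p" and S: "weakly_seq_continuous S"
    and X: "X \<longlonglongrightarrow> x" and lim: "(\<lambda>n. cost p (X n - (S (v n), v n))) \<longlonglongrightarrow> D"
    and min: "\<And>w. D \<le> cost p (x - (S w, w))"
  obtains r l where "strict_mono (r :: nat \<Rightarrow> nat)" "(\<lambda>n. (S (v (r n)), v (r n))) \<longlonglongrightarrow> (S l, l)"
    "cost p (x - (S l, l)) = D"
proof -
  obtain M1 where M1: "\<And>n. norm (X n) \<le> M1"
    using X convergent_imp_Bseq[of X] unfolding convergent_def Bseq_def by metis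
  obtain M2 where M2: "\<And>n. norm (cost p (X n - (S (v n), v n))) \<le> M2"
    using lim convergent_imp_Bseq[of "\<lambda>n. cost p (X n - (S (v n), v n))"]
    unfolding convergent_def Bseq_def by metis
  have "norm (v n) \<le> M1 + M2 powr (1 / p)" for n
  proof -
    have "norm (snd (X n - (S (v n), v n))) \<le> pnorm p (X n - (S (v n), v n))"
      using p by (intro norm_snd_le_pnorm) auto
    also have "\<dots> \<le> M2 powr (1 / p)"
      unfolding pnorm_def using M2[of n] p by (intro powr_mono2) (auto simp: cost_nonneg)
    finally have "norm (snd (X n) - v n) \<le> M2 powr (1 / p)" by simp
    moreover have "norm (snd (X n)) \<le> M1" using M1[of n] norm_snd_le[of "snd (X n)" "fst (X n)"] by simp
    ultimately show ?thesis using norm_triangle_ineq4[of "snd (X n)" "snd (X n) - v n"] by simp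
  qed
  \<comment> \<open>Compactness is needed for \<open>v\<close> only; weak continuity of
    \<open>S\<close> carries the other component and places the limit on the graph.\<close>
  then obtain r l where r: "strict_mono r" and "converges_weakly (v \<circ> r) l"
    using weakly_convergent_subsequence[OF uc(2) us(2)] by blast
  then have wv: "converges_weakly (\<lambda>n. v (r n)) l" by (simp add: o_def)
  then have wS: "converges_weakly (\<lambda>n. S (v (r n))) (S l)"
    using S unfolding weakly_seq_continuous_def by blast
  have Xr: "(\<lambda>n. X (r n)) \<longlonglongrightarrow> x" using LIMSEQ_subseq_LIMSEQ[OF X r] by (simp add: o_def)
  define a b where "a n = fst (X (r n)) - S (v (r n))" and "b n = snd (X (r n)) - v (r n)" for n
  define a' b' where "a' = fst x - S l" and "b' = snd x - l"
  have wa: "converges_weakly a a'" and wb: "converges_weakly b b'"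
    unfolding a_def b_def a'_def b'_def
    by (intro converges_weakly_diff tendsto_converges_weakly tendsto_fst tendsto_snd Xr wv wS)+
  have lim': "(\<lambda>n. norm (a n) powr p + norm (b n) powr p) \<longlonglongrightarrow> D"
    using LIMSEQ_subseq_LIMSEQ[OF lim r] by (simp add: o_def cost_def a_def b_def)
  \<comment> \<open>The weak limit \<open>l\<close> is itself a competitor. This excludes any loss
    of norm in the limit and is the inequality that \<open>tendsto_summand\<close> consumes.\<close>
  have D: "D \<le> norm a' powr p + norm b' powr p"
    using min[of l] by (simp add: cost_def a'_def b'_def)
  have p0: "0 < p" using p by simp
  have la: "(\<lambda>n. norm (a n) powr p) \<longlonglongrightarrow> norm a' powr p"
    by (rule tendsto_summand[OF lim' D norm_powr_weak_lower_semicontinuous[OF us(1) wa p0]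
          norm_powr_weak_lower_semicontinuous[OF us(2) wb p0]])
  have lb: "(\<lambda>n. norm (b n) powr p) \<longlonglongrightarrow> norm b' powr p"
    by (rule tendsto_summand[OF _ _ norm_powr_weak_lower_semicontinuous[OF us(2) wb p0]
          norm_powr_weak_lower_semicontinuous[OF us(1) wa p0]])
       (use lim' D in \<open>simp_all add: add.commute\<close>)
  have "a \<longlonglongrightarrow> a'" using Kadec_Klee[OF uc(1) us(1) wa norm_tendsto_of_powr[OF p0 la]] .
  then have "(\<lambda>n. fst (X (r n)) - a n) \<longlonglongrightarrow> fst x - a'" using Xr by (intro tendsto_intros)
  then have 1: "(\<lambda>n. S (v (r n))) \<longlonglongrightarrow> S l" by (simp add: a_def a'_def)
  have "b \<longlonglongrightarrow> b'" using Kadec_Klee[OF uc(2) us(2) wb norm_tendsto_of_powr[OF p0 lb]] .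
  then have "(\<lambda>n. snd (X (r n)) - b n) \<longlonglongrightarrow> snd x - b'" using Xr by (intro tendsto_intros)
  then have 2: "(\<lambda>n. v (r n)) \<longlonglongrightarrow> l" by (simp add: b_def b'_def)
  have "norm a' powr p + norm b' powr p = D"
    using LIMSEQ_unique[OF tendsto_add[OF la lb] lim'] .
  then have "cost p (x - (S l, l)) = D" by (simp add: cost_def a'_def b'_def)
  then show thesis using that[OF r tendsto_Pair[OF 1 2]] by blast
qed

text \<open>The second component of a graph point determines the first, so \<open>S\<close>
  preserves convex combinations. For \<open>L\<close>, which fixes 0, combinations with 0 give
  scaling by factors in the unit interval, reciprocals give larger factors, and doubled midpoints
  give additivity.\<close>

lemma affine_linear_if_convex_graph:
  assumes "convex (range (\<lambda>v. (S v, v)))"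
  shows "affine_linear S"
proof -
  have comb: "S (s *\<^sub>R u + t *\<^sub>R v) = s *\<^sub>R S u + t *\<^sub>R S v" if "0 \<le> s" "0 \<le> t" "s + t = 1" for s t u v
  proof -
    have "s *\<^sub>R (S u, u) + t *\<^sub>R (S v, v) \<in> range (\<lambda>v. (S v, v))"
      using that by (intro convexD[OF assms]) auto
    then show ?thesis by auto
  qed
  define L where "L u = S u - S 0" for u
  have L_comb: "L (s *\<^sub>R u + t *\<^sub>R v) = s *\<^sub>R L u + t *\<^sub>R L v" if "0 \<le> s" "0 \<le> t" "s + t = 1" for s t u v
  proof -
    have "s *\<^sub>R L u + t *\<^sub>R L v = s *\<^sub>R S u + t *\<^sub>R S v - (s + t) *\<^sub>R S 0"
      by (simp add: L_def algebra_simps)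
    then show ?thesis using that by (simp add: L_def comb)
  qed
  have L0: "L 0 = 0" by (simp add: L_def)
  have L_small: "L (s *\<^sub>R u) = s *\<^sub>R L u" if "0 \<le> s" "s \<le> 1" for s u
    using L_comb[of s "1 - s" u 0] that by (simp add: L0)
  have L_pos: "L (s *\<^sub>R u) = s *\<^sub>R L u" if "0 \<le> s" for s u
  proof (cases "s \<le> 1")
    case False
    then have "L u = (1 / s) *\<^sub>R L (s *\<^sub>R u)" using L_small[of "1 / s" "s *\<^sub>R u"] by simp
    then show ?thesis using False by simp
  qed (use that L_small in simp)
  have L_add: "L (u + v) = L u + L v" for u v
  proof -
    have "u + v = 2 *\<^sub>R ((1/2) *\<^sub>R u + (1/2) *\<^sub>R v)" by (simp add: scaleR_add_right)
    then have "L (u + v) = 2 *\<^sub>R L ((1/2) *\<^sub>R u + (1/2) *\<^sub>R v)" using L_pos by simp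
    also have "\<dots> = L u + L v" using L_comb[of "1/2" "1/2" u v] by (simp add: scaleR_add_right)
    finally show ?thesis .
  qed
  have L_neg: "L (- u) = - L u" for u
    using L_add[of u "- u"] L0 by (simp add: eq_neg_iff_add_eq_0 add.commute)
  have "linear L"
  proof (rule linearI)
    show "L (s *\<^sub>R u) = s *\<^sub>R L u" for s u
      using L_pos[of s u] L_pos[of "- s" u] L_neg[of "s *\<^sub>R u"] by (cases "0 \<le> s") auto
  qed (rule L_add)
  then show ?thesis unfolding affine_linear_def
    by (intro exI[of _ L] exI[of _ "S 0"]) (auto simp: L_def)
qed

theorem theorem2p3:
  fixes S :: "'u::banach \<Rightarrow> 'y::banach" and p :: real
  assumes "uniformly_convex TYPE('y)" and "uniformly_smooth TYPE('y)"
    and "uniformly_convex TYPE('u)" and "uniformly_smooth TYPE('u)"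
    and "1 < p"
    and "\<not> affine_linear S"
    and "weakly_seq_continuous S"
  shows "\<exists>(y\<^sub>d :: 'y) (u\<^sub>d :: 'u). \<exists>z\<^sub>1 z\<^sub>2. z\<^sub>1 \<noteq> z\<^sub>2 \<and>
    global_solution p S y\<^sub>d u\<^sub>d z\<^sub>1 \<and> global_solution p S y\<^sub>d u\<^sub>d z\<^sub>2"
proof (rule ccontr)
  assume contra: "\<not> ?thesis"
  have p: "1 \<le> p" "0 < p" using assms(5) by auto
  define G where "G v = (S v, v)" for v
  have sol: "global_solution p S (fst x) (snd x) (G v) \<longleftrightarrow> (\<forall>w. cost p (x - G v) \<le> cost p (x - G w))"
    for x :: "'y \<times> 'u" and v
    by (simp add: global_solution_def G_def cost_def norm_minus_commute)
  \<comment> \<open>A point \<open>x\<close> of the product is a choice of data, and global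
    solutions for it are its nearest points on the graph.\<close>
  have unique: "G v = G w"
    if "\<And>k. cost p (x - G v) \<le> cost p (x - G k)" "\<And>k. cost p (x - G w) \<le> cost p (x - G k)" for x v w
    using contra that sol[of x v] sol[of x w] by blast
  note minimizing = graph_minimizing_sequence[OF assms(1,3,2,4,5,7), folded G_def]
  have ex: "\<exists>v. \<forall>w. cost p (x - G v) \<le> cost p (x - G w)" for x :: "'y \<times> 'u"
  proof -
    define D where "D = (INF w. cost p (x - G w))"
    have bdd: "bdd_below (range (\<lambda>w. cost p (x - G w)))"
      by (intro bdd_belowI2[of _ 0]) (simp add: cost_nonneg)
    have D_le: "D \<le> cost p (x - G w)" for w unfolding D_def by (intro cINF_lower bdd) simp
    have "\<exists>v. cost p (x - G v) < D + inverse (real (Suc n))" for n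
      using cINF_less_iff[OF _ bdd, of "D + inverse (real (Suc n))"] by (auto simp: D_def)
    then obtain v where v: "\<And>n. cost p (x - G (v n)) < D + inverse (real (Suc n))" by metis
    have "(\<lambda>n. cost p (x - G (v n))) \<longlonglongrightarrow> D"
      by (rule tendsto_sandwich[OF _ _ tendsto_const LIMSEQ_inverse_real_of_nat_add[of D]])
         (use D_le v in \<open>auto intro!: always_eventually less_imp_le\<close>)
    then obtain l where "cost p (x - G l) = D"
      by (rule minimizing[OF tendsto_const]) (rule D_le)
    then show ?thesis using D_le by metis
  qed
  then obtain \<pi> where \<pi>: "\<And>x w. cost p (x - G (\<pi> x)) \<le> cost p (x - G w)" by metis
  define P where "P x = G (\<pi> x)" for x
  interpret pn: smooth_equivalent_norm "pnorm p :: 'y \<times> 'u \<Rightarrow> real" "1 / 2" 2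
  proof
    show "1 / 2 * norm z \<le> pnorm p z" for z :: "'y \<times> 'u" using norm_le_pnorm[OF p(2), of z] by simp
    show "0 < \<epsilon> \<Longrightarrow> \<exists>\<delta>>0. \<forall>x y :: 'y \<times> 'u. pnorm p x = 1 \<longrightarrow> pnorm p y \<le> \<delta>
        \<longrightarrow> pnorm p (x + y) + pnorm p (x - y) \<le> 2 + \<epsilon> * pnorm p y" for \<epsilon>
      by (rule pnorm_smooth[OF assms(2,4,5)])
    show "pnorm p z \<le> 2 * norm z" for z :: "'y \<times> 'u" by (rule pnorm_le_norm[OF p(1)])
  qed (simp_all add: pnorm_triangle[OF p(1)] pnorm_scaleR[OF p(2)])
  have P_min: "pnorm p (x - P x) \<le> pnorm p (x - G w)" for x w
    unfolding P_def using p \<pi> by (intro pnorm_mono)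
  have "isCont P x" for x
  proof (rule ccontr)
    assume "\<not> isCont P x"
    then obtain e where e: "0 < e" "\<And>\<delta>. 0 < \<delta> \<Longrightarrow> \<exists>y. dist y x < \<delta> \<and> e \<le> dist (P y) (P x)"
      unfolding continuous_at_eps_delta by (meson not_less)
    have "\<exists>y. dist y x < inverse (real (Suc n)) \<and> e \<le> dist (P y) (P x)" for n
      by (intro e) simp
    then obtain X where X: "\<And>n. dist (X n) x < inverse (real (Suc n))" "\<And>n. e \<le> dist (P (X n)) (P x)"
      by metis
    have Xx: "X \<longlonglongrightarrow> x"
      unfolding tendsto_dist_iff[of X]
      by (rule tendsto_sandwich[OF _ _ tendsto_const LIMSEQ_inverse_real_of_nat])
         (use X(1) in \<open>auto intro!: always_eventually less_imp_le\<close>)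
    \<comment> \<open>Continuity of the distance has to be shown before that of \<open>P\<close>:
      \<open>P (X n)\<close> competes for \<open>x\<close>, and \<open>P x\<close> competes for
      \<open>X n\<close>.\<close>
    have "(\<lambda>n. pnorm p (X n - P (X n))) \<longlonglongrightarrow> pnorm p (x - P x)"
    proof (rule tendsto_sandwich)
      show "\<forall>\<^sub>F n in sequentially. pnorm p (x - P x) - pnorm p (x - X n) \<le> pnorm p (X n - P (X n))"
      proof (intro always_eventually allI)
        fix n
        show "pnorm p (x - P x) - pnorm p (x - X n) \<le> pnorm p (X n - P (X n))"
          using P_min[of x "\<pi> (X n)"] pn.triangle_diff[of x "P (X n)" "X n"] by (simp add: P_def)
      qed
      show "\<forall>\<^sub>F n in sequentially. pnorm p (X n - P (X n)) \<le> pnorm p (X n - P x)"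
        using P_min by (simp add: P_def)
      have "(\<lambda>n. pnorm p (x - P x) - pnorm p (x - X n)) \<longlonglongrightarrow> pnorm p (x - P x) - pnorm p (x - x)"
        by (intro tendsto_diff pn.tendsto_N tendsto_const Xx)
      then show "(\<lambda>n. pnorm p (x - P x) - pnorm p (x - X n)) \<longlonglongrightarrow> pnorm p (x - P x)"
        using pn.N_zero by simp
      show "(\<lambda>n. pnorm p (X n - P x)) \<longlonglongrightarrow> pnorm p (x - P x)"
        by (intro tendsto_diff pn.tendsto_N tendsto_const Xx)
    qed
    then have "(\<lambda>n. pnorm p (X n - P (X n)) powr p) \<longlonglongrightarrow> pnorm p (x - P x) powr p"
      using p by (intro tendsto_powr'[OF _ tendsto_const]) (auto simp: pnorm_nonneg)
    then have lim: "(\<lambda>n. cost p (X n - G (\<pi> (X n)))) \<longlonglongrightarrow> cost p (x - G (\<pi> x))"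
      using p by (simp add: pnorm_powr P_def)
    obtain r l where r: "(\<lambda>n. G (\<pi> (X (r n)))) \<longlonglongrightarrow> G l" "cost p (x - G l) = cost p (x - G (\<pi> x))"
      by (rule minimizing[OF Xx lim \<pi>])
    have "cost p (x - G l) \<le> cost p (x - G k)" for k unfolding r(2) by (rule \<pi>)
    \<comment> \<open>The negated conclusion enters only here: the limit of the projections is a
      nearest point of \<open>x\<close>, hence the chosen one, although all \<open>P (X n)\<close>
      stay at distance at least \<open>e\<close> from it.\<close>
    then have "G l = P x" unfolding P_def by (rule unique[OF _ \<pi>])
    then have "(\<lambda>n. P (X (r n))) \<longlonglongrightarrow> P x" using r(1) by (simp add: P_def)
    then have "\<forall>\<^sub>F n in sequentially. dist (P (X (r n))) (P x) < e" using e(1) by (rule tendstoD)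
    then obtain n where "dist (P (X (r n))) (P x) < e"
      using eventually_happens'[OF sequentially_bot] by blast
    then show False using X(2)[of "r n"] by simp
  qed
  then interpret continuous_projection "pnorm p :: 'y \<times> 'u \<Rightarrow> real" "1 / 2" 2 "range G" P
    by unfold_locales (use P_min in \<open>auto simp: P_def\<close>)
  have "affine_linear S"
    using convex_K by (intro affine_linear_if_convex_graph) (simp add: G_def[abs_def])
  then show False using assms(6) by contradiction
qed

end
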